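(* Let $k\ge1$ be an integer, $a\in C^1([0,1])$, $a>0$ in $[0,1]$. Let $u_0>0$ and let $f\in C^1([0,\infty))$ satisfy $f(0)=f(u_0)=0$, $f(s)<0$ for $s\in(0,u_0)$, $f(s)>0$ for $s\in(u_0,\infty)$, and $f'(u_0)>\lambda_{k+1}$. Consider the problem $$-\left(\frac{u'}{\sqrt{1+u'^2}}\right)'=a(x)f(u)\ \text{ in }(0,1),\qquad u>0\ \text{ in }(0,1),\qquad u'(0)=u'(1)=0.\quad(P)$$ 1. If $$a(0)\exp\Big(\int_0^1\frac{(a')^+(x)}{a(x)}dx\Big)\int_{u_0}^0 f(s)\,ds<1,$$ then there exist at least $k$ non-constant $C^2$-solutions $u_1,\dots,u_k$ of $(P)$ such that, for every $j=1,\dots,k$, there exist exactly $j+2$ points $0=x_{j,0}<x_{j,1}<\dots<x_{j,j}<x_{j,j+1}=1$ with (a) $u_j\in C^2([0,x_{j,1}))\cap C^2((x_{j,j},1])$, $u_j\in C^2((x_{j,i},x_{j,i+1}))$ for $i=1,\dots,j-1$, and $u_j'(0)=0=u_j'(1)$; (b) $(-1)^{i+1}(u_j(x)-u_0)>0$ for every $x\in(x_{j,i},x_{j,i+1})$, $i=0,\dots,j$; (c) for every $i=1,\dots,j$: $u_j(x_{j,i})=u_0$ and $u_j\in C^2((x_{j,i-1},x_{j,i+1}))$. 2. If $$a(0)\exp\Big(\int_0^1\frac{(a')^+(x)}{a(x)}dx\Big)\int_{u_0}^{+\infty} f(s)\,ds<1,$$ then there exist at least $k$ non-constant $C^2$-solutions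 $u_{k+1},\dots,u_{2k}$ of $(P)$ such that, for every $\ell=1,\dots,k$, there exist exactly $\ell+2$ points $0=x_{\ell,0}<x_{\ell,1}<\dots<x_{\ell,\ell}<x_{\ell,\ell+1}=1$ with (a) $u_{2k+1-\ell}\in C^2([0,x_{\ell,1}))\cap C^2((x_{\ell,\ell},1])$, $u_{2k+1-\ell}\in C^2((x_{\ell,i},x_{\ell,i+1}))$ for $i=1,\dots,\ell-1$, and $u_{2k+1-\ell}'(0)=0=u_{2k+1-\ell}'(1)$; (b) $(-1)^{i+1}(u_{2k+1-\ell}(x)-u_0)<0$ for every $x\in(x_{\ell,i},x_{\ell,i+1})$, $i=0,\dots,\ell$; (c) for every $i=1,\dots,\ell$: $u_{2k+1-\ell}(x_{\ell,i})=u_0$ and $u_{2k+1-\ell}\in C^2((x_{\ell,i-1},x_{\ell,i+1}))$.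
   Context: For a real function $g$, $g^+=\max\{g,0\}$. $\lambda_k$ ($k\ge1$) is the $k$-th eigenvalue of $-u''=\lambda a(x)u$ in $(0,1)$ with $u'(0)=u'(1)=0$, so that $0=\lambda_1<\lambda_2<\lambda_3<\dots\to\infty$. A $C^2$-solution of $(P)$ is a function $u\in C^2([0,1])$ satisfying $(P)$ pointwise. *)

theory Defs
  imports "HOL-Analysis.Analysis"
begin

text \<open>
  Derivative relative to \<open>S\<close>: it is one-sided at an endpoint of an interval \<open>S\<close> that belongs
  to \<open>S\<close>, and the ordinary derivative at interior points. Used only for intervals \<open>S\<close> with
  nonempty interior, where it is uniquely determined.
\<close>
definition deriv_on :: "real set \<Rightarrow> (real \<Rightarrow> real) \<Rightarrow> real \<Rightarrow> real" where
  "deriv_on S f x = vector_derivative f (at x within S)"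

primrec Ck_on :: "nat \<Rightarrow> real set \<Rightarrow> (real \<Rightarrow> real) \<Rightarrow> bool" where
  "Ck_on 0 S f \<longleftrightarrow> continuous_on S f"
| "Ck_on (Suc n) S f \<longleftrightarrow> f differentiable_on S \<and> Ck_on n S (deriv_on S f)"

definition neumann_eigenvalue :: "(real \<Rightarrow> real) \<Rightarrow> real \<Rightarrow> bool" where
  "neumann_eigenvalue a l \<longleftrightarrow>
     (\<exists>u. Ck_on 2 {0..1} u \<and> (\<exists>x\<in>{0..1}. u x \<noteq> 0) \<and>
          (\<forall>x\<in>{0<..<1}. - deriv_on {0..1} (deriv_on {0..1} u) x = l * a x * u x) \<and>
          deriv_on {0..1} u 0 = 0 \<and> deriv_on {0..1} u 1 = 0)"

text \<open>
  \<open>l\<close> is the \<open>n\<close>-th eigenvalue in increasing order, counted from \<open>n = 1\<close>. All eigenvalues are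
  simple, so no multiplicities enter the count.
\<close>
definition nth_neumann_eigenvalue :: "(real \<Rightarrow> real) \<Rightarrow> nat \<Rightarrow> real \<Rightarrow> bool" where
  "nth_neumann_eigenvalue a n l \<longleftrightarrow>
     neumann_eigenvalue a l \<and>
     finite {m. neumann_eigenvalue a m \<and> m < l} \<and>
     card {m. neumann_eigenvalue a m \<and> m < l} + 1 = n"

definition C2_solution :: "(real \<Rightarrow> real) \<Rightarrow> (real \<Rightarrow> real) \<Rightarrow> (real \<Rightarrow> real) \<Rightarrow> bool" where
  "C2_solution a f u \<longleftrightarrow>
     Ck_on 2 {0..1} u \<and>
     (\<forall>x\<in>{0<..<1}.
        - deriv_on {0..1} (\<lambda>t. deriv_on {0..1} u t / sqrt (1 + (deriv_on {0..1} u t)\<^sup>2)) x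
          = a x * f (u x)) \<and>
     (\<forall>x\<in>{0<..<1}. u x > 0) \<and>
     deriv_on {0..1} u 0 = 0 \<and> deriv_on {0..1} u 1 = 0"

text \<open>
  \<open>x 0 < \<dots> < x (n + 1)\<close> are the nodal points of \<open>u - u0\<close>, endpoints included; \<open>rel\<close> is \<open>(>)\<close> if
  \<open>u\<close> starts below \<open>u0\<close> and \<open>(<)\<close> if it starts above. Only \<open>x 0, \<dots>, x (n + 1)\<close> matter.
\<close>
definition nodal_points ::
  "(real \<Rightarrow> real \<Rightarrow> bool) \<Rightarrow> real \<Rightarrow> (real \<Rightarrow> real) \<Rightarrow> nat \<Rightarrow> (nat \<Rightarrow> real) \<Rightarrow> bool" where
  "nodal_points rel u0 u n x \<longleftrightarrow>
     x 0 = 0 \<and> x (n + 1) = 1 \<and> strict_mono_on {0..n + 1} x \<and>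
     Ck_on 2 {0..<x 1} u \<and> Ck_on 2 {x n<..1} u \<and>
     (\<forall>i\<in>{1..<n}. Ck_on 2 {x i<..<x (i + 1)} u) \<and>
     deriv_on {0..1} u 0 = 0 \<and> deriv_on {0..1} u 1 = 0 \<and>
     (\<forall>i\<in>{0..n}. \<forall>t\<in>{x i<..<x (i + 1)}. rel ((-1) ^ (i + 1) * (u t - u0)) 0) \<and>
     (\<forall>i\<in>{1..n}. u (x i) = u0 \<and> Ck_on 2 {x (i - 1)<..<x (i + 1)} u)"

text \<open>
  ``There exist exactly \<open>n + 2\<close> points'': no other choice of points, of whatever number, is
  possible.
\<close>
definition exactly_nodal_points ::
  "(real \<Rightarrow> real \<Rightarrow> bool) \<Rightarrow> real \<Rightarrow> (real \<Rightarrow> real) \<Rightarrow> nat \<Rightarrow> bool" where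
  "exactly_nodal_points rel u0 u n \<longleftrightarrow>
     (\<exists>x. nodal_points rel u0 u n x \<and>
          (\<forall>m y. nodal_points rel u0 u m y \<longrightarrow> m = n \<and> (\<forall>i\<in>{0..n + 1}. y i = x i)))"

end

theory Submission imports Defs begin

text \<open>
  The solutions are found by shooting. With \<open>w = u' / sqrt (1 + u'\<^sup>2)\<close> the equation becomes the
  planar system \<open>u' = w / sqrt (1 - w\<^sup>2)\<close>, \<open>w' = - a f(u)\<close>. Let \<open>F\<close> be the primitive of \<open>f\<close>
  vanishing at \<open>u0\<close>. The energy \<open>1 - sqrt (1 - w\<^sup>2) + a F(u)\<close> grows at most at the rate
  \<open>(a')\<^sup>+ / a\<close>, so the smallness assumption keeps \<open>\<bar>w\<bar>\<close> below a constant \<open>d < 1\<close>, for all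
  initial values \<open>c = u(0)\<close> on the relevant side of \<open>u0\<close>. The polar angle of \<open>(u - u0, - w)\<close> at
  \<open>x = 1\<close>, counted from its value at \<open>x = 0\<close>, depends continuously on \<open>c \<noteq> u0\<close>. For \<open>c\<close> near \<open>u0\<close> it exceeds that of the \<open>(k + 1)\<close>-st
  eigenfunction, which is at least \<open>k \<pi>\<close>; for \<open>c = 0\<close>, and for large \<open>c\<close>, the solution
  never meets \<open>u0\<close> and the angle stays below \<open>\<pi>\<close>. The intermediate value theorem yields the
  angles \<open>\<pi>, \<dots>, k \<pi>\<close>, and the angle is strictly increasing in \<open>x\<close>, so the one with angle \<open>j \<pi>\<close>
  meets \<open>u0\<close> exactly \<open>j\<close> times.
\<close>

section \<open>Calculus on a compact interval\<close>

lemma within_deriv_mono: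
  fixes f :: "real \<Rightarrow> real"
  assumes der: "\<And>x. x \<in> {p..q} \<Longrightarrow> (f has_real_derivative f' x) (at x within {p..q})"
    and st: "p \<le> s" "s \<le> t" "t \<le> q"
    and nonneg: "\<And>x. s < x \<Longrightarrow> x < t \<Longrightarrow> 0 \<le> f' x"
  shows "f s \<le> f t"
proof (cases "s = t")
  case False
  have "continuous_on {p..q} f"
    by (rule DERIV_continuous_on) (rule der)
  then have cont: "continuous_on {s..t} f"
    by (rule continuous_on_subset) (use st in auto)
  show ?thesis
  proof (rule DERIV_nonneg_imp_increasing_open[OF _ _ cont])
    fix x assume x: "s < x" "x < t"
    then have "(f has_real_derivative f' x) (at x)"
      using der[of x] st at_within_Icc_at[of p x q] by simp
    then show "\<exists>y. (f has_real_derivative y) (at x) \<and> 0 \<le> y"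
      using nonneg[OF x] by blast
  qed (use st False in simp)
qed simp

lemma within_deriv_strict_mono:
  fixes f :: "real \<Rightarrow> real"
  assumes der: "\<And>x. x \<in> {p..q} \<Longrightarrow> (f has_real_derivative f' x) (at x within {p..q})"
    and st: "p \<le> s" "s < t" "t \<le> q"
    and pos: "\<And>x. s < x \<Longrightarrow> x < t \<Longrightarrow> 0 < f' x"
  shows "f s < f t"
proof -
  have "continuous_on {p..q} f"
    by (rule DERIV_continuous_on) (rule der)
  then have cont: "continuous_on {s..t} f"
    by (rule continuous_on_subset) (use st in auto)
  show ?thesis
  proof (rule DERIV_pos_imp_increasing_open[OF _ _ cont])
    fix x assume x: "s < x" "x < t"
    then have "(f has_real_derivative f' x) (at x)"
      using der[of x] st at_within_Icc_at[of p x q] by simp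
    then show "\<exists>y. (f has_real_derivative y) (at x) \<and> 0 < y"
      using pos[OF x] by blast
  qed (use st in simp)
qed

text \<open>Working with \<open>z \<bullet> z\<close> avoids the corner of the norm at zeros of
  \<open>z\<close>. Cauchy-Schwarz bounds its derivative by \<open>2 * L\<close> times itself, and
  an exponential weight turns this into monotonicity. The estimate runs in both time directions, so
  it later gives lower bounds on solutions as well as upper ones.\<close>

lemma gronwall_norm:
  fixes z :: "real \<Rightarrow> 'a::real_inner"
  assumes der: "\<And>t. t \<in> {p..q} \<Longrightarrow> (z has_vector_derivative z' t) (at t within {p..q})"
    and bound: "\<And>t. t \<in> {p..q} \<Longrightarrow> norm (z' t) \<le> L * norm (z t)"
    and s: "s \<in> {p..q}" and t: "t \<in> {p..q}"
  shows "norm (z t) \<le> norm (z s) * exp (L * \<bar>t - s\<bar>)"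
proof -
  define N where "N t = z t \<bullet> z t" for t
  have derN: "(N has_real_derivative 2 * (z x \<bullet> z' x)) (at x within {p..q})"
    if "x \<in> {p..q}" for x
  proof -
    have "((\<lambda>t. z t \<bullet> z t) has_derivative (\<lambda>h. z x \<bullet> (h *\<^sub>R z' x) + (h *\<^sub>R z' x) \<bullet> z x))
        (at x within {p..q})"
      using der[OF that] unfolding has_vector_derivative_def
      by (intro has_derivative_inner) auto
    moreover have "(\<lambda>h. z x \<bullet> (h *\<^sub>R z' x) + (h *\<^sub>R z' x) \<bullet> z x) = (*) (2 * (z x \<bullet> z' x))"
      by (auto simp: inner_commute)
    ultimately show ?thesis
      unfolding N_def[abs_def] has_field_derivative_def by simp
  qed
  have absN: "\<bar>2 * (z x \<bullet> z' x)\<bar> \<le> 2 * L * N x" if "x \<in> {p..q}" for x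
  proof -
    have "\<bar>z x \<bullet> z' x\<bar> \<le> norm (z x) * norm (z' x)"
      by (rule Cauchy_Schwarz_ineq2)
    also have "\<dots> \<le> norm (z x) * (L * norm (z x))"
      by (rule mult_left_mono[OF bound[OF that]]) simp
    finally show ?thesis
      unfolding N_def by (simp add: dot_square_norm power2_eq_square mult_ac)
  qed
  have Nexp: "N t \<le> N s * exp (2 * L * \<bar>t - s\<bar>)"
  proof (cases "s \<le> t")
    case True
    define E where "E x = - (exp (- (2 * L * x)) * N x)" for x
    have E: "(E has_real_derivative exp (- (2 * L * x)) * (2 * L * N x - 2 * (z x \<bullet> z' x)))
        (at x within {p..q})" if "x \<in> {p..q}" for x
      unfolding E_def using derN[OF that] by (auto intro!: derivative_eq_intros simp: algebra_simps)
    have "E s \<le> E t"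
    proof (rule within_deriv_mono[OF E])
      fix x assume "s < x" "x < t"
      then have "x \<in> {p..q}" using s t by auto
      from absN[OF this] show "0 \<le> exp (- (2 * L * x)) * (2 * L * N x - 2 * (z x \<bullet> z' x))"
        by (intro mult_nonneg_nonneg) auto
    qed (use s t True in auto)
    then have "exp (2 * L * t) * (exp (- (2 * L * t)) * N t)
        \<le> exp (2 * L * t) * (exp (- (2 * L * s)) * N s)"
      by (intro mult_left_mono) (auto simp: E_def)
    then show ?thesis
      using True by (simp add: exp_minus exp_diff field_simps flip: exp_add)
  next
    case False
    define E where "E x = exp (2 * L * x) * N x" for x
    have E: "(E has_real_derivative exp (2 * L * x) * (2 * L * N x + 2 * (z x \<bullet> z' x)))
        (at x within {p..q})" if "x \<in> {p..q}" for x
      unfolding E_def using derN[OF that] by (auto intro!: derivative_eq_intros simp: algebra_simps)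
    have "E t \<le> E s"
    proof (rule within_deriv_mono[OF E])
      fix x assume "t < x" "x < s"
      then have "x \<in> {p..q}" using s t by auto
      from absN[OF this] show "0 \<le> exp (2 * L * x) * (2 * L * N x + 2 * (z x \<bullet> z' x))"
        by (intro mult_nonneg_nonneg) auto
    qed (use s t False in auto)
    then have "exp (- (2 * L * t)) * (exp (2 * L * t) * N t)
        \<le> exp (- (2 * L * t)) * (exp (2 * L * s) * N s)"
      by (intro mult_left_mono) (auto simp: E_def)
    then show ?thesis
      using False by (simp add: exp_minus exp_diff field_simps flip: exp_add)
  qed
  have "(norm (z t))\<^sup>2 \<le> (norm (z s) * exp (L * \<bar>t - s\<bar>))\<^sup>2"
  proof -
    have "(exp (L * \<bar>t - s\<bar>))\<^sup>2 = exp (2 * L * \<bar>t - s\<bar>)"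
      by (simp add: exp_double[symmetric] mult_ac)
    then show ?thesis
      using Nexp by (simp add: N_def power_mult_distrib dot_square_norm)
  qed
  then show ?thesis
    by (rule power2_le_imp_le) simp
qed

text \<open>Gronwall from \<open>s\<close> to \<open>t\<close> and back. This is the form in which
  uniqueness for initial value problems is applied to eigenfunctions and to rest points.\<close>

lemma within_deriv_zero_iff:
  fixes z :: "real \<Rightarrow> 'a::real_inner"
  assumes "\<And>t. t \<in> {p..q} \<Longrightarrow> (z has_vector_derivative z' t) (at t within {p..q})"
    and "\<And>t. t \<in> {p..q} \<Longrightarrow> norm (z' t) \<le> L * norm (z t)"
    and "s \<in> {p..q}" "t \<in> {p..q}"
  shows "z t = 0 \<longleftrightarrow> z s = 0"
  using gronwall_norm[OF assms] gronwall_norm[OF assms(1,2,4,3)] by auto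

section \<open>The initial value problem for a Lipschitz vector field\<close>

text \<open>
  In the weighted unknown \<open>exp (- 2 L t) z t\<close> the integral operator is a contraction with
  constant \<open>1 / 2\<close> on the whole interval, so no gluing of local solutions is needed.
\<close>
lemma lipschitz_ivp_solution:
  fixes X :: "real \<Rightarrow> 'a::{real_inner,banach} \<Rightarrow> 'a"
  assumes cont: "\<And>z. continuous_on {0..1} z \<Longrightarrow> continuous_on {0..1} (\<lambda>t. X t (z t))"
    and lip: "\<And>t z w. t \<in> {0..1} \<Longrightarrow> norm (X t z - X t w) \<le> L * norm (z - w)"
    and L: "0 < L"
  shows "\<exists>z. z 0 = z0 \<and>
    (\<forall>t\<in>{0..1}. (z has_vector_derivative X t (z t)) (at t within {0..1}))"
proof -
  define K where "K = 2 * L"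
  have K: "K > 0" using L by (simp add: K_def)
  \<comment> \<open>Bounded continuous functions are taken on the whole line, so the integral
    operator is composed with the retraction \<open>cl\<close> onto \<open>{0..1}\<close>.
    \<open>V\<close> undoes the weight before \<open>X\<close> is applied, and \<open>T\<close> puts
    it back.\<close>
  define cl :: "real \<Rightarrow> real" where "cl t = max 0 (min 1 t)" for t
  have cl: "cl t \<in> {0..1}" for t by (auto simp: cl_def)
  have cont_cl: "continuous_on UNIV cl" unfolding cl_def by (intro continuous_intros)
  define V where "V \<psi> s = X s (exp (K * s) *\<^sub>R \<psi> s)" for \<psi> :: "real \<Rightarrow> 'a" and s
  define T where "T \<psi> t = exp (- (K * cl t)) *\<^sub>R (z0 + integral {0..cl t} (V \<psi>))"
    for \<psi> :: "real \<Rightarrow> 'a" and t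
  have contV: "continuous_on {0..1} (V (apply_bcontfun \<psi>))" for \<psi>
    unfolding V_def by (intro cont continuous_intros) auto
  have Tb: "T (apply_bcontfun \<psi>) \<in> bcontfun" for \<psi>
  proof -
    let ?I = "\<lambda>t. exp (- (K * t)) *\<^sub>R (z0 + integral {0..t} (V (apply_bcontfun \<psi>)))"
    have cI: "continuous_on {0..1} ?I"
      by (intro continuous_intros indefinite_integral_continuous_1 integrable_continuous_real contV)
    have "continuous_on UNIV (\<lambda>t. ?I (cl t))"
      by (rule continuous_on_compose2[OF cI cont_cl]) (use cl in auto)
    moreover have "bounded (range (\<lambda>t. ?I (cl t)))"
      by (rule bounded_subset[OF compact_imp_bounded[OF compact_continuous_image[OF cI compact_Icc]]])
        (use cl in auto)
    ultimately show ?thesis unfolding bcontfun_def T_def[abs_def] by simp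
  qed
  define B where "B \<psi> = Bcontfun (T (apply_bcontfun \<psi>))" for \<psi>
  have B: "apply_bcontfun (B \<psi>) = T (apply_bcontfun \<psi>)" for \<psi>
    unfolding B_def by (rule Bcontfun_inverse[OF Tb])
  have intexp: "((\<lambda>s. exp (K * s)) has_integral (exp (K * t) - 1) / K) {0..t}" if "0 \<le> t" for t
  proof -
    have "((\<lambda>s. exp (K * s)) has_integral exp (K * t) / K - exp (K * 0) / K) {0..t}"
      by (rule fundamental_theorem_of_calculus[OF that])
        (use K in \<open>auto intro!: derivative_eq_intros simp flip: has_real_derivative_iff_has_vector_derivative\<close>)
    then show ?thesis by (simp add: diff_divide_distrib)
  qed
  have "dist (B \<phi>) (B \<psi>) \<le> 1 / 2 * dist \<phi> \<psi>" for \<phi> \<psi>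
  proof (rule dist_bound)
    fix t
    let ?c = "cl t"
    let ?D = "dist \<phi> \<psi>"
    have V: "V (apply_bcontfun \<theta>) integrable_on {0..?c}" for \<theta>
      by (rule integrable_continuous_real, rule continuous_on_subset[OF contV]) (use cl[of t] in auto)
    have "norm (integral {0..?c} (\<lambda>s. V (apply_bcontfun \<phi>) s - V (apply_bcontfun \<psi>) s))
        \<le> integral {0..?c} (\<lambda>s. L * ?D * exp (K * s))"
    proof (rule integral_norm_bound_integral)
      show "(\<lambda>s. V (apply_bcontfun \<phi>) s - V (apply_bcontfun \<psi>) s) integrable_on {0..?c}"
        by (intro integrable_diff V)
      show "(\<lambda>s. L * ?D * exp (K * s)) integrable_on {0..?c}"
        by (intro integrable_continuous_real continuous_intros)
      fix s assume s: "s \<in> {0..?c}"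
      then have "s \<in> {0..1}" using cl[of t] by auto
      then have "norm (V (apply_bcontfun \<phi>) s - V (apply_bcontfun \<psi>) s)
          \<le> L * norm (exp (K * s) *\<^sub>R \<phi> s - exp (K * s) *\<^sub>R \<psi> s)"
        unfolding V_def by (rule lip)
      also have "\<dots> = L * (exp (K * s) * dist (\<phi> s) (\<psi> s))"
        by (simp add: dist_norm flip: scaleR_diff_right)
      also have "\<dots> \<le> L * (exp (K * s) * ?D)"
        using L by (intro mult_left_mono dist_bounded) auto
      finally show "norm (V (apply_bcontfun \<phi>) s - V (apply_bcontfun \<psi>) s) \<le> L * ?D * exp (K * s)"
        by (simp add: mult_ac)
    qed
    also have "\<dots> = L * ?D * ((exp (K * ?c) - 1) / K)"
      using integral_unique[OF has_integral_mult_right[OF intexp, of ?c "L * ?D"]] cl[of t] by simp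
    also have "\<dots> \<le> L * ?D * (exp (K * ?c) / K)"
      using L K by (intro mult_left_mono divide_right_mono) auto
    also have "\<dots> = 1 / 2 * ?D * exp (K * ?c)"
      using L by (simp add: K_def)
    finally have *: "norm (integral {0..?c} (\<lambda>s. V (apply_bcontfun \<phi>) s - V (apply_bcontfun \<psi>) s))
        \<le> 1 / 2 * ?D * exp (K * ?c)" .
    have "dist (B \<phi> t) (B \<psi> t) = exp (- (K * ?c)) *
        norm (integral {0..?c} (\<lambda>s. V (apply_bcontfun \<phi>) s - V (apply_bcontfun \<psi>) s))"
      unfolding B T_def dist_norm by (simp add: Henstock_Kurzweil_Integration.integral_diff V flip: scaleR_diff_right)
    also have "\<dots> \<le> exp (- (K * ?c)) * (1 / 2 * ?D * exp (K * ?c))"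
      by (rule mult_left_mono[OF *]) simp
    also have "\<dots> = 1 / 2 * ?D" by (simp add: exp_minus)
    finally show "dist (B \<phi> t) (B \<psi> t) \<le> 1 / 2 * ?D" .
  qed
  then have "\<exists>!\<psi>. B \<psi> = \<psi>"
    by (intro banach_fix_type[of "1 / 2"]) auto
  then obtain \<psi> where "B \<psi> = \<psi>" by blast
  with B[of \<psi>] have \<psi>: "apply_bcontfun \<psi> t = T (apply_bcontfun \<psi>) t" for t by metis
  define z where "z t = z0 + integral {0..t} (V (apply_bcontfun \<psi>))" for t
  have z: "exp (K * t) *\<^sub>R \<psi> t = z t" if "t \<in> {0..1}" for t
  proof -
    have "cl t = t" using that by (auto simp: cl_def)
    then show ?thesis using \<psi>[of t] by (simp add: T_def z_def exp_minus)
  qed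
  have "(z has_vector_derivative X t (z t)) (at t within {0..1})" if "t \<in> {0..1}" for t
  proof -
    have "(z has_vector_derivative 0 + V (apply_bcontfun \<psi>) t) (at t within {0..1})"
      unfolding z_def
      by (intro has_vector_derivative_add has_vector_derivative_const integral_has_vector_derivative contV that)
    then show ?thesis by (simp add: V_def z[OF that])
  qed
  moreover have "z 0 = z0" by (simp add: z_def)
  ultimately show ?thesis by blast
qed

section \<open>The polar angle of a nonvanishing path\<close>

text \<open>The imaginary part of a logarithm of \<open>z t / z 0\<close>, lifted continuously by
  integrating \<open>z' / z\<close>, so no branch of the argument has to be chosen. It counts the
  turning from time \<open>0\<close> and starts at \<open>0\<close> whatever \<open>z 0\<close>
  is.\<close>

definition polar_angle :: "(real \<Rightarrow> complex) \<Rightarrow> (real \<Rightarrow> complex) \<Rightarrow> real \<Rightarrow> real" where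
  "polar_angle z z' t = Im (integral {0..t} (\<lambda>s. z' s / z s))"

lemma polar_angle_0 [simp]: "polar_angle z z' 0 = 0"
  by (simp add: polar_angle_def)

locale nonvanishing_path =
  fixes z z' :: "real \<Rightarrow> complex"
  assumes z_deriv: "t \<in> {0..1} \<Longrightarrow> (z has_vector_derivative z' t) (at t within {0..1})"
    and z'_cont: "continuous_on {0..1} z'"
    and z_nz: "t \<in> {0..1} \<Longrightarrow> z t \<noteq> 0"
begin

lemma z_cont: "continuous_on {0..1} z"
  using z_deriv has_vector_derivative_continuous continuous_on_eq_continuous_within by blast

lemma quot_cont: "continuous_on {0..1} (\<lambda>s. z' s / z s)"
  by (intro continuous_intros z'_cont z_cont) (use z_nz in auto)

lemma polar_angle_deriv:
  assumes "t \<in> {0..1}"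
  shows "(polar_angle z z' has_real_derivative Im (z' t / z t)) (at t within {0..1})"
  unfolding polar_angle_def has_real_derivative_iff_has_vector_derivative
  by (rule bounded_linear.has_vector_derivative[OF bounded_linear_Im
        integral_has_vector_derivative[OF quot_cont assms]])

lemma path_eq_exp:
  assumes t: "t \<in> {0..1}"
  shows "z t = z 0 * exp (integral {0..t} (\<lambda>s. z' s / z s))"
proof -
  define I where "I t = integral {0..t} (\<lambda>s. z' s / z s)" for t
  have I: "(I has_vector_derivative z' s / z s) (at s within {0..1})" if "s \<in> {0..1}" for s
    unfolding I_def by (rule integral_has_vector_derivative[OF quot_cont that])
  have "((\<lambda>s. z s * exp (- I s)) has_vector_derivative 0) (at s within {0..1})"
    if s: "s \<in> {0..1}" for s
  proof -
    have e: "((\<lambda>s. exp (- I s)) has_vector_derivative (- (z' s / z s)) * exp (- I s)) (at s within {0..1})"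
      by (rule field_vector_diff_chain_within[where g = exp and f = "\<lambda>s. - I s", unfolded o_def])
        (auto intro!: has_vector_derivative_minus I s DERIV_exp[THEN has_field_derivative_at_within])
    show ?thesis
      using has_vector_derivative_mult[OF z_deriv[OF s] e] z_nz[OF s]
      by (simp add: field_simps)
  qed
  then obtain c where c: "\<And>s. s \<in> {0..1} \<Longrightarrow> z s * exp (- I s) = c"
    using has_vector_derivative_zero_constant[of "{0..1}" "\<lambda>s. z s * exp (- I s)"]
    by (metis convex_real_interval(5))
  have "z t * exp (- I t) = z 0 * exp (- I 0)" using c[OF t] c[of 0] by simp
  then show ?thesis by (simp add: I_def exp_minus field_simps)
qed

text \<open>For a real starting point the signed factor \<open>Re (z 0)\<close> takes the place of
  the modulus, so a path starting on the negative half-axis has initial angle \<open>0\<close> as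
  well. Starts on either side of \<open>u0\<close> are thereby treated alike.\<close>

lemma polar_form:
  assumes t: "t \<in> {0..1}" and re: "Im (z 0) = 0"
  obtains r where "r > 0" "Re (z t) = Re (z 0) * r * cos (polar_angle z z' t)"
    "Im (z t) = Re (z 0) * r * sin (polar_angle z z' t)"
proof -
  let ?I = "integral {0..t} (\<lambda>s. z' s / z s)"
  have z0: "z 0 = of_real (Re (z 0))" using re by (simp add: complex_eq_iff)
  have "z t = of_real (Re (z 0)) * exp ?I" using path_eq_exp[OF t] z0 by simp
  then have "Re (z t) = Re (z 0) * exp (Re ?I) * cos (Im ?I)"
    "Im (z t) = Re (z 0) * exp (Re ?I) * sin (Im ?I)"
    by (simp_all add: Re_exp Im_exp)
  then show ?thesis using that[of "exp (Re ?I)"] by (simp add: polar_angle_def)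
qed

lemma Im_quot: "Im (z' t / z t) = (Im (z' t) * Re (z t) - Re (z' t) * Im (z t)) / (cmod (z t))\<^sup>2"
  by (simp add: Im_divide cmod_power2)

text \<open>Squaring removes the sign of \<open>Re (z 0)\<close> and dividing removes the radius.
  Quadratic expressions in the path thus become expressions in the angle, as the Prufer equation
  requires.\<close>

lemma polar_angle_squares:
  assumes t: "t \<in> {0..1}" and re: "Im (z 0) = 0"
  shows "(cos (polar_angle z z' t))\<^sup>2 = (Re (z t))\<^sup>2 / (cmod (z t))\<^sup>2"
    and "(sin (polar_angle z z' t))\<^sup>2 = (Im (z t))\<^sup>2 / (cmod (z t))\<^sup>2"
proof -
  from polar_form[OF t re] obtain r where r: "r > 0"
    "Re (z t) = Re (z 0) * r * cos (polar_angle z z' t)"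
    "Im (z t) = Re (z 0) * r * sin (polar_angle z z' t)" by blast
  have "Re (z 0) \<noteq> 0" using z_nz[of 0] re by (auto simp: complex_eq_iff)
  moreover have "(cmod (z t))\<^sup>2 = (Re (z 0) * r)\<^sup>2"
    unfolding cmod_power2 r(2,3) power_mult_distrib by (simp flip: distrib_left)
  ultimately show "(cos (polar_angle z z' t))\<^sup>2 = (Re (z t))\<^sup>2 / (cmod (z t))\<^sup>2"
    "(sin (polar_angle z z' t))\<^sup>2 = (Im (z t))\<^sup>2 / (cmod (z t))\<^sup>2"
    unfolding r(2,3) power_mult_distrib using r(1) by simp_all
qed

end

section \<open>Comparison of Prufer angles\<close>

text \<open>
  For \<open>D = \<theta> - \<tau>\<close> one only gets \<open>D' \<ge> - K \<bar>D\<bar>\<close>; this is turned into \<open>D \<ge> 0\<close> by a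
  Gronwall argument for the square of the negative part of \<open>D\<close>.
\<close>
lemma prufer_comparison:
  fixes \<theta> \<tau> a :: "real \<Rightarrow> real"
  assumes th: "\<And>t. t \<in> {0..1} \<Longrightarrow> (\<theta> has_real_derivative \<theta>' t) (at t within {0..1})"
    and ta: "\<And>t. t \<in> {0..1} \<Longrightarrow> (\<tau> has_real_derivative \<tau>' t) (at t within {0..1})"
    and th': "\<And>t. t \<in> {0..1} \<Longrightarrow> (sin (\<theta> t))\<^sup>2 + \<mu> * a t * (cos (\<theta> t))\<^sup>2 \<le> \<theta>' t"
    and ta': "\<And>t. t \<in> {0..1} \<Longrightarrow> \<tau>' t \<le> (sin (\<tau> t))\<^sup>2 + l * a t * (cos (\<tau> t))\<^sup>2"
    and a: "\<And>t. t \<in> {0..1} \<Longrightarrow> 0 < a t" "\<And>t. t \<in> {0..1} \<Longrightarrow> a t \<le> b"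
    and l: "l < \<mu>" and init: "\<theta> 0 = 0" "\<tau> 0 = 0"
  shows "\<tau> 1 < \<theta> 1"
proof -
  \<comment> \<open>A Lipschitz constant in the angle: the right-hand side for \<open>l\<close>
    equals \<open>l * a + (1 - l * a) * sin\<^sup>2\<close>, where
    \<open>\<bar>1 - l * a\<bar>\<close> is at most \<open>K\<close> and \<open>sin\<^sup>2\<close>
    is 1-Lipschitz.\<close>
  define K where "K = 1 + \<bar>l\<bar> * b"
  define D where "D t = \<theta> t - \<tau> t" for t
  define D' where "D' t = \<theta>' t - \<tau>' t" for t
  have D: "(D has_real_derivative D' t) (at t within {0..1})" if "t \<in> {0..1}" for t
    unfolding D_def[abs_def] D'_def by (intro DERIV_diff th ta that)
  have D'_ge: "- K * \<bar>D t\<bar> + (\<mu> - l) * a t * (cos (\<theta> t))\<^sup>2 \<le> D' t" if t: "t \<in> {0..1}" for t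
  proof -
    have "(sin (\<theta> t))\<^sup>2 - (sin (\<tau> t))\<^sup>2 = sin (\<theta> t + \<tau> t) * sin (\<theta> t - \<tau> t)"
    proof -
      have "sin (\<theta> t + \<tau> t) * sin (\<theta> t - \<tau> t)
          = (sin (\<theta> t))\<^sup>2 * (cos (\<tau> t))\<^sup>2 - (cos (\<theta> t))\<^sup>2 * (sin (\<tau> t))\<^sup>2"
        unfolding sin_add sin_diff by (simp add: algebra_simps power2_eq_square)
      also have "\<dots> = (sin (\<theta> t))\<^sup>2 - (sin (\<tau> t))\<^sup>2"
        unfolding cos_squared_eq by (simp add: algebra_simps)
      finally show ?thesis by simp
    qed
    moreover have "\<bar>sin (\<theta> t + \<tau> t) * sin (\<theta> t - \<tau> t)\<bar> \<le> 1 * \<bar>D t\<bar>"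
      unfolding abs_mult D_def by (intro mult_mono abs_sin_x_le_abs_x) auto
    ultimately have s: "\<bar>(sin (\<theta> t))\<^sup>2 - (sin (\<tau> t))\<^sup>2\<bar> \<le> \<bar>D t\<bar>" by simp
    have "\<bar>1 - l * a t\<bar> \<le> K"
    proof -
      have "\<bar>l * a t\<bar> \<le> \<bar>l\<bar> * b" unfolding abs_mult using a[OF t] by (intro mult_left_mono) auto
      then show ?thesis unfolding K_def by linarith
    qed
    with s have "\<bar>(1 - l * a t) * ((sin (\<theta> t))\<^sup>2 - (sin (\<tau> t))\<^sup>2)\<bar> \<le> K * \<bar>D t\<bar>"
      unfolding abs_mult by (intro mult_mono) auto
    moreover have "(1 - l * a t) * ((sin (\<theta> t))\<^sup>2 - (sin (\<tau> t))\<^sup>2)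
        = ((sin (\<theta> t))\<^sup>2 + l * a t * (cos (\<theta> t))\<^sup>2) - ((sin (\<tau> t))\<^sup>2 + l * a t * (cos (\<tau> t))\<^sup>2)"
      unfolding cos_squared_eq by (simp add: algebra_simps)
    moreover have "(sin (\<theta> t))\<^sup>2 + \<mu> * a t * (cos (\<theta> t))\<^sup>2
        = (sin (\<theta> t))\<^sup>2 + l * a t * (cos (\<theta> t))\<^sup>2 + (\<mu> - l) * a t * (cos (\<theta> t))\<^sup>2"
      by (simp add: algebra_simps)
    ultimately show ?thesis using th'[OF t] ta'[OF t] unfolding D'_def by linarith
  qed
  have K0: "0 \<le> K" using a[of 0] unfolding K_def by (smt (verit) atLeastAtMost_iff mult_nonneg_nonneg)
  have pos: "0 \<le> (\<mu> - l) * a t * (cos (\<theta> t))\<^sup>2" if "t \<in> {0..1}" for t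
    using l a(1)[OF that] by auto
  \<comment> \<open>The square of the negative part is differentiable at \<open>0\<close> too, where
    the negative part itself has a corner.\<close>
  define n where "n s = (min s 0)\<^sup>2" for s :: real
  have n: "(n has_real_derivative 2 * min s 0) (at s)" for s
  proof -
    consider "s < 0" | "s > 0" | "s = 0" by linarith
    then show ?thesis
    proof cases
      case 1
      have "((\<lambda>s. s\<^sup>2) has_real_derivative 2 * min s 0) (at s)"
        using 1 by (auto intro!: derivative_eq_intros)
      then show ?thesis
        by (rule has_field_derivative_transform_within_open[of _ _ _ "{..<0}"]) (use 1 in \<open>auto simp: n_def\<close>)
    next
      case 2
      have "((\<lambda>s. 0) has_real_derivative 2 * min s 0) (at s)"
        using 2 by (auto intro!: derivative_eq_intros)
      then show ?thesis
        by (rule has_field_derivative_transform_within_open[of _ _ _ "{0<..}"]) (use 2 in \<open>auto simp: n_def\<close>)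
    next
      case 3
      have "((\<lambda>h. n h / h) \<longlongrightarrow> 0) (at 0)"
      proof (rule Lim_null_comparison[of _ "\<lambda>h. \<bar>h\<bar>"])
        show "\<forall>\<^sub>F h in at 0. norm (n h / h) \<le> \<bar>h\<bar>"
          by (auto simp: n_def min_def power2_eq_square)
        show "((\<lambda>h. \<bar>h\<bar>) \<longlongrightarrow> 0) (at (0::real))" by (auto intro!: tendsto_eq_intros)
      qed
      then show ?thesis using 3 by (simp add: DERIV_def n_def)
    qed
  qed
  have D0: "0 \<le> D t" if t: "t \<in> {0..1}" for t
  proof -
    define E where "E x = - (exp (- (2 * K * x)) * n (D x))" for x
    have E: "(E has_real_derivative
        exp (- (2 * K * x)) * (2 * K * n (D x) - 2 * min (D x) 0 * D' x)) (at x within {0..1})"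
      if x: "x \<in> {0..1}" for x
    proof -
      have "((\<lambda>x. n (D x)) has_real_derivative 2 * min (D x) 0 * D' x) (at x within {0..1})"
        by (rule DERIV_chain2[OF n D[OF x]])
      then show ?thesis
        unfolding E_def by (auto intro!: derivative_eq_intros simp: algebra_simps)
    qed
    have "E 0 \<le> E t"
    proof (rule within_deriv_mono[OF E])
      fix x :: real assume "0 < x" "x < t"
      then have x: "x \<in> {0..1}" using t by auto
      have "0 \<le> 2 * K * n (D x) - 2 * min (D x) 0 * D' x"
      proof (cases "D x < 0")
        case True
        have "D' x \<ge> K * D x" using D'_ge[OF x] pos[OF x] True by auto
        then have "D x * D' x \<le> D x * (K * D x)"
          using True by (intro mult_left_mono_neg) auto
        then show ?thesis using True by (simp add: n_def power2_eq_square mult_ac)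
      qed (simp add: n_def)
      then show "0 \<le> exp (- (2 * K * x)) * (2 * K * n (D x) - 2 * min (D x) 0 * D' x)"
        by simp
    qed (use t in auto)
    then have "n (D t) \<le> 0" by (simp add: E_def n_def D_def init mult_le_0_iff)
    then show ?thesis by (auto simp: n_def min_def split: if_splits)
  qed
  \<comment> \<open>Now that \<open>D\<close> is nonnegative, \<open>exp (K * x) * D x\<close> is
    nondecreasing. Its derivative keeps the term with \<open>(\<mu> - l) * a * cos\<^sup>2\<close>,
    which is positive near \<open>x = 0\<close> because \<open>\<theta> 0 = 0\<close>; this makes
    the final inequality strict.\<close>
  define E where "E x = exp (K * x) * D x" for x
  define E' where "E' x = exp (K * x) * (K * D x + D' x)" for x
  have E: "(E has_real_derivative E' x) (at x within {0..1})" if "x \<in> {0..1}" for x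
    unfolding E_def E'_def using D[OF that] by (auto intro!: derivative_eq_intros simp: algebra_simps)
  have E': "exp (K * x) * ((\<mu> - l) * a x * (cos (\<theta> x))\<^sup>2) \<le> E' x" if "x \<in> {0..1}" for x
    unfolding E'_def using D'_ge[OF that] D0[OF that] by (intro mult_left_mono) auto
  have "continuous_on {0..1} (\<lambda>t. cos (\<theta> t))"
    by (intro continuous_on_cos DERIV_continuous_on[OF th])
  from this[unfolded continuous_on_iff, rule_format, of 0 1]
  obtain e where e: "e > 0"
    and cos: "\<And>x. x \<in> {0..1} \<Longrightarrow> \<bar>x\<bar> < e \<Longrightarrow> \<bar>cos (\<theta> x) - 1\<bar> < 1"
    by (auto simp: dist_real_def init)
  define x1 where "x1 = min 1 (e / 2)"
  have x1: "0 < x1" "x1 \<le> 1" "x1 < e" using e by (auto simp: x1_def min_def)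
  have "E 0 < E x1"
  proof (rule within_deriv_strict_mono[OF E])
    fix x assume x: "0 < x" "x < x1"
    then have x': "x \<in> {0..1}" using x1 by auto
    have "cos (\<theta> x) \<noteq> 0" using cos[OF x'] x x1 by auto
    then have "0 < exp (K * x) * ((\<mu> - l) * a x * (cos (\<theta> x))\<^sup>2)"
      using l a(1)[OF x'] by simp
    then show "0 < E' x" using E'[OF x'] by linarith
  qed (use x1 in auto)
  also have "E x1 \<le> E 1"
  proof (rule within_deriv_mono[OF E])
    fix x assume x: "x1 < x" "x < 1"
    then have x': "x \<in> {0..1}" using x1 by auto
    have "0 \<le> exp (K * x) * ((\<mu> - l) * a x * (cos (\<theta> x))\<^sup>2)" using pos[OF x'] by simp
    then show "0 \<le> E' x" using E'[OF x'] by linarith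
  qed (use x1 in auto)
  finally show ?thesis by (simp add: E_def D_def init zero_less_mult_iff)
qed

section \<open>Relative derivatives\<close>

lemma has_real_derivative_transform:
  assumes "x \<in> T" "\<And>y. y \<in> T \<Longrightarrow> g y = f y" "(f has_real_derivative D) (at x within T)"
  shows "(g has_real_derivative D) (at x within T)"
  using has_vector_derivative_transform[of x T g f D] assms
  by (simp add: has_real_derivative_iff_has_vector_derivative)

lemma deriv_on_eqI:
  assumes "(f has_real_derivative D) (at x within T)" "x islimpt T"
  shows "deriv_on T f x = D"
  unfolding deriv_on_def
  using assms by (intro vector_derivative_within)
    (simp_all add: trivial_limit_within flip: has_real_derivative_iff_has_vector_derivative)

lemma deriv_on_works:
  assumes "f differentiable_on T" "x \<in> T"
  shows "(f has_real_derivative deriv_on T f x) (at x within T)"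
  using assms unfolding deriv_on_def differentiable_on_def
  by (simp add: has_real_derivative_iff_has_vector_derivative flip: vector_derivative_works)

lemma islimpt_interval_real:
  fixes T :: "real set"
  assumes "connected T" "p \<in> T" "q \<in> T" "p < q" "x \<in> T"
  shows "x islimpt T"
  using assms by (intro connected_imp_perfect) auto

lemma Ck_on_2I:
  assumes u: "\<And>x. x \<in> T \<Longrightarrow> (u has_real_derivative v x) (at x within T)"
    and v: "\<And>x. x \<in> T \<Longrightarrow> (v has_real_derivative w x) (at x within T)"
    and w: "continuous_on T w" and lim: "\<And>x. x \<in> T \<Longrightarrow> x islimpt T"
  shows "Ck_on 2 T u"
proof -
  have du: "deriv_on T u x = v x" if "x \<in> T" for x
    using deriv_on_eqI[OF u lim] that by blast
  have v': "(deriv_on T u has_real_derivative w x) (at x within T)" if "x \<in> T" for x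
    by (rule has_real_derivative_transform[OF that _ v[OF that]]) (simp add: du)
  have "deriv_on T (deriv_on T u) x = w x" if "x \<in> T" for x
    using deriv_on_eqI[OF v' lim] that by blast
  then have "continuous_on T (deriv_on T (deriv_on T u))"
    using w by (simp cong: continuous_on_cong)
  then show ?thesis
    using u v' unfolding numeral_2_eq_2 Ck_on.simps differentiable_on_def
    by (auto simp: real_differentiable_def)
qed

lemma Ck_on_2D:
  assumes "Ck_on 2 T u"
  shows "x \<in> T \<Longrightarrow> (u has_real_derivative deriv_on T u x) (at x within T)"
    and "x \<in> T \<Longrightarrow> (deriv_on T u has_real_derivative deriv_on T (deriv_on T u) x) (at x within T)"
    and "continuous_on T (deriv_on T (deriv_on T u))"
  using assms unfolding numeral_2_eq_2 Ck_on.simps by (auto intro: deriv_on_works)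

lemma Ck_on_1D:
  assumes "Ck_on 1 T u"
  shows "x \<in> T \<Longrightarrow> (u has_real_derivative deriv_on T u x) (at x within T)"
    and "continuous_on T (deriv_on T u)"
  using assms unfolding One_nat_def Ck_on.simps by (auto intro: deriv_on_works)

section \<open>Rotation of the Neumann eigenfunctions\<close>

text \<open>The Prufer equation: \<open>\<theta>\<close> is the angle of \<open>(v, - v')\<close>
  for a nontrivial solution of \<open>- v'' = l * a * v\<close> with
  \<open>v' 0 = 0\<close>.\<close>

definition prufer_solution :: "(real \<Rightarrow> real) \<Rightarrow> real \<Rightarrow> (real \<Rightarrow> real) \<Rightarrow> bool" where
  "prufer_solution a l \<theta> \<longleftrightarrow> \<theta> 0 = 0 \<and>
     (\<forall>t\<in>{0..1}. (\<theta> has_real_derivative (sin (\<theta> t))\<^sup>2 + l * a t * (cos (\<theta> t))\<^sup>2) (at t within {0..1}))"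

text \<open>The eigenvalue equation is given in the open interval only. Both of its sides are
  continuous on the closed interval, so it extends to the endpoints.\<close>

lemma neumann_eigenfunctionE:
  assumes "neumann_eigenvalue a l" and a: "continuous_on {0..1} a"
  obtains v v' where
    "\<And>t. t \<in> {0..1} \<Longrightarrow> (v has_real_derivative v' t) (at t within {0..1})"
    "\<And>t. t \<in> {0..1} \<Longrightarrow> (v' has_real_derivative - (l * a t * v t)) (at t within {0..1})"
    "v' 0 = 0" "v' 1 = 0" "\<exists>t\<in>{0..1}. v t \<noteq> 0"
proof -
  from assms(1) obtain v where C2: "Ck_on 2 {0..1} v" and nz: "\<exists>x\<in>{0..1}. v x \<noteq> 0"
    and eq: "\<And>x. x \<in> {0<..<1} \<Longrightarrow> - deriv_on {0..1} (deriv_on {0..1} v) x = l * a x * v x"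
    and bc: "deriv_on {0..1} v 0 = 0" "deriv_on {0..1} v 1 = 0"
    unfolding neumann_eigenvalue_def by blast
  let ?v2 = "deriv_on {0..1} (deriv_on {0..1} v)"
  have cv: "continuous_on {0..1} v"
    by (rule DERIV_continuous_on[OF Ck_on_2D(1)[OF C2]])
  have "continuous_on (closure {0<..<1}) (\<lambda>t. ?v2 t + l * a t * v t)"
    using a cv Ck_on_2D(3)[OF C2] by (auto intro!: continuous_intros)
  moreover have "?v2 t + l * a t * v t = 0" if "t \<in> {0<..<1}" for t
    using eq[OF that] by linarith
  ultimately have "?v2 t + l * a t * v t = 0" if "t \<in> closure {0<..<1}" for t
    using continuous_constant_on_closure that by blast
  then have "?v2 t = - (l * a t * v t)" if "t \<in> {0..1}" for t
    using that by (simp add: add_eq_0_iff2)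
  with that[OF Ck_on_2D(1)[OF C2] _ bc nz] Ck_on_2D(2)[OF C2] show ?thesis by metis
qed

text \<open>The product \<open>v * v'\<close> vanishes at both ends, and for \<open>l < 0\<close>
  its derivative is a sum of two nonnegative terms. The product is then constant, both terms vanish,
  and so does \<open>v\<close>.\<close>

lemma neumann_eigenvalue_nonneg:
  assumes ev: "neumann_eigenvalue a l"
    and a: "continuous_on {0..1} a" "\<And>t. t \<in> {0..1} \<Longrightarrow> 0 < a t"
  shows "0 \<le> l"
proof (rule ccontr)
  assume l: "\<not> 0 \<le> l"
  from neumann_eigenfunctionE[OF ev a(1)] obtain v v' where
    v: "\<And>t. t \<in> {0..1} \<Longrightarrow> (v has_real_derivative v' t) (at t within {0..1})"
    and v': "\<And>t. t \<in> {0..1} \<Longrightarrow> (v' has_real_derivative - (l * a t * v t)) (at t within {0..1})"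
    and bc: "v' 0 = 0" "v' 1 = 0" and nz: "\<exists>t\<in>{0..1}. v t \<noteq> 0" by blast
  define E where "E t = v t * v' t" for t
  define E' where "E' t = (v' t)\<^sup>2 + (- l) * a t * (v t)\<^sup>2" for t
  have E: "(E has_real_derivative E' t) (at t within {0..1})" if "t \<in> {0..1}" for t
    unfolding E_def E'_def using v[OF that] v'[OF that]
    by (auto intro!: derivative_eq_intros simp: power2_eq_square algebra_simps)
  have E'1: "0 \<le> (- l) * a t * (v t)\<^sup>2" if "t \<in> {0..1}" for t
    using l a(2)[OF that] by (intro mult_nonneg_nonneg) auto
  have E'2: "0 \<le> E' t" if "t \<in> {0..1}" for t
    using E'1[OF that] unfolding E'_def by (intro add_nonneg_nonneg) auto
  have "E t = 0" if t: "t \<in> {0..1}" for t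
  proof -
    have "E 0 \<le> E t" using t E'2 by (intro within_deriv_mono[OF E]) auto
    moreover have "E t \<le> E 1" using t E'2 by (intro within_deriv_mono[OF E]) auto
    ultimately show ?thesis by (simp add: E_def bc)
  qed
  then have "((\<lambda>_. 0) has_real_derivative E' t) (at t within {0..1})" if "t \<in> {0..1}" for t
    by (intro has_real_derivative_transform[OF that _ E[OF that]]) auto
  then have E'0: "E' t = 0" if "t \<in> {0..1}" for t
    using that islimpt_interval_real[of "{0..1}" 0 1 t]
      deriv_on_eqI[of "\<lambda>_. 0" 0 t "{0..1}"] deriv_on_eqI[of "\<lambda>_. 0" "E' t" t "{0..1}"] by auto
  have "v t = 0" if "t \<in> {0..1}" for t
  proof -
    have "(- l) * a t * (v t)\<^sup>2 = 0"
      using E'1[OF that] E'0[OF that] zero_le_power2[of "v' t"] unfolding E'_def by linarith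
    then show ?thesis using l a(2)[OF that] by auto
  qed
  with nz show False by blast
qed

text \<open>By uniqueness the vector \<open>(v, - v')\<close> never vanishes, so it has a polar
  angle. The boundary condition at \<open>1\<close> makes the final angle an integer multiple of
  \<open>pi\<close>, and \<open>l \<ge> 0\<close> makes the angle nondecreasing, so the multiple is
  a natural number.\<close>

lemma neumann_eigenvalue_prufer:
  assumes ev: "neumann_eigenvalue a l"
    and a: "continuous_on {0..1} a" "\<And>t. t \<in> {0..1} \<Longrightarrow> 0 < a t"
  shows "\<exists>\<theta> (n::nat). prufer_solution a l \<theta> \<and> \<theta> 1 = n * pi"
proof -
  from neumann_eigenfunctionE[OF ev a(1)] obtain v v' where
    v: "\<And>t. t \<in> {0..1} \<Longrightarrow> (v has_real_derivative v' t) (at t within {0..1})"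
    and v': "\<And>t. t \<in> {0..1} \<Longrightarrow> (v' has_real_derivative - (l * a t * v t)) (at t within {0..1})"
    and bc: "v' 0 = 0" "v' 1 = 0" and nz: "\<exists>t\<in>{0..1}. v t \<noteq> 0" by blast
  have l: "0 \<le> l" by (rule neumann_eigenvalue_nonneg[OF ev a])
  have cv: "continuous_on {0..1} v" by (rule DERIV_continuous_on[OF v])
  have cv': "continuous_on {0..1} v'" by (rule DERIV_continuous_on[OF v'])
  obtain b where b: "\<And>t. t \<in> {0..1} \<Longrightarrow> a t \<le> b"
    using continuous_attains_sup[OF compact_Icc _ a(1)] by (metis atLeastAtMost_iff empty_iff order_refl zero_le_one)
  define z where "z t = Complex (v t) (- v' t)" for t
  define z' where "z' t = Complex (v' t) (l * a t * v t)" for t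
  have z: "(z has_vector_derivative z' t) (at t within {0..1})" if "t \<in> {0..1}" for t
    unfolding z_def z'_def
    using v[OF that] DERIV_minus[OF v'[OF that]]
    by (simp add: has_vector_derivative_complex_iff has_real_derivative_iff_has_vector_derivative)
  have bound: "norm (z' t) \<le> (1 + l * b) * norm (z t)" if t: "t \<in> {0..1}" for t
  proof -
    have "norm (z' t) \<le> \<bar>v' t\<bar> + l * a t * \<bar>v t\<bar>"
      using cmod_le[of "z' t"] a(2)[OF t] l by (simp add: z'_def abs_mult)
    also have "\<dots> \<le> norm (z t) + l * b * norm (z t)"
      using abs_Re_le_cmod[of "z t"] abs_Im_le_cmod[of "z t"] l b[OF t] a(2)[OF t]
      by (intro add_mono mult_mono) (auto simp: z_def)
    finally show ?thesis by (simp add: algebra_simps)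
  qed
  from nz obtain s where s: "s \<in> {0..1}" "z s \<noteq> 0" by (auto simp: z_def complex_eq_iff)
  interpret nonvanishing_path z z'
  proof
    show "continuous_on {0..1} z'" unfolding z'_def Complex_eq
      by (intro continuous_intros cv cv' a)
    show "z t \<noteq> 0" if "t \<in> {0..1}" for t
      using within_deriv_zero_iff[OF z bound s(1) that] s(2) by blast
  qed (rule z)
  let ?\<theta> = "polar_angle z z'"
  have re: "Im (z 0) = 0" by (simp add: z_def bc)
  have der: "(?\<theta> has_real_derivative (sin (?\<theta> t))\<^sup>2 + l * a t * (cos (?\<theta> t))\<^sup>2) (at t within {0..1})"
    if t: "t \<in> {0..1}" for t
  proof -
    have "Im (z' t / z t) = (sin (?\<theta> t))\<^sup>2 + l * a t * (cos (?\<theta> t))\<^sup>2"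
      unfolding Im_quot polar_angle_squares[OF t re]
      by (simp add: z_def z'_def power2_eq_square add_divide_distrib)
    with polar_angle_deriv[OF t] show ?thesis by simp
  qed
  have "?\<theta> 0 \<le> ?\<theta> 1"
    using l a(2) by (intro within_deriv_mono[OF der]) (auto intro!: add_nonneg_nonneg mult_nonneg_nonneg simp: less_imp_le)
  then have ge: "0 \<le> ?\<theta> 1" by simp
  have one: "(1::real) \<in> {0..1}" by simp
  have "(sin (?\<theta> 1))\<^sup>2 = 0"
    unfolding polar_angle_squares(2)[OF one re] by (simp add: z_def bc)
  then obtain n :: int where n: "?\<theta> 1 = n * pi"
    using sin_zero_iff_int2[of "?\<theta> 1"] by auto
  have "0 \<le> n"
  proof (rule ccontr)
    assume "\<not> 0 \<le> n"
    then have "real_of_int n * pi < 0" by (intro mult_neg_pos) auto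
    then show False using ge n by simp
  qed
  then have "?\<theta> 1 = nat n * pi" using n by simp
  moreover have "prufer_solution a l ?\<theta>" using der by (simp add: prufer_solution_def)
  ultimately show ?thesis by blast
qed

text \<open>By comparison the multiple \<open>N m\<close> is strictly increasing in the eigenvalue
  \<open>m\<close>. The \<open>k\<close> eigenvalues below \<open>l\<close> thus have distinct
  natural numbers below \<open>N l\<close>, which forces \<open>k \<le> N l\<close>.\<close>

lemma nth_neumann_eigenvalue_prufer:
  assumes nth: "nth_neumann_eigenvalue a (k + 1) l"
    and a: "continuous_on {0..1} a" "\<And>t. t \<in> {0..1} \<Longrightarrow> 0 < a t"
  shows "\<exists>\<theta>. prufer_solution a l \<theta> \<and> k * pi \<le> \<theta> 1"
proof -
  define S where "S = {m. neumann_eigenvalue a m \<and> m < l}"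
  have ev: "neumann_eigenvalue a l" and S: "finite S" "card S = k"
    using nth unfolding nth_neumann_eigenvalue_def S_def by auto
  obtain b where b: "\<And>t. t \<in> {0..1} \<Longrightarrow> a t \<le> b"
    using continuous_attains_sup[OF compact_Icc _ a(1)] by (metis atLeastAtMost_iff empty_iff order_refl zero_le_one)
  obtain \<Theta> and N :: "real \<Rightarrow> nat" where \<Theta>: "\<And>m. neumann_eigenvalue a m \<Longrightarrow> prufer_solution a m (\<Theta> m)"
    and N: "\<And>m. neumann_eigenvalue a m \<Longrightarrow> \<Theta> m 1 = N m * pi"
    using neumann_eigenvalue_prufer[OF _ a] by metis
  have less: "N m < N m'" if "neumann_eigenvalue a m" "neumann_eigenvalue a m'" "m < m'" for m m'
  proof -
    have "\<Theta> m 1 < \<Theta> m' 1"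
    proof (rule prufer_comparison)
      fix t :: real assume "t \<in> {0..1}"
      then show "(\<Theta> m has_real_derivative (sin (\<Theta> m t))\<^sup>2 + m * a t * (cos (\<Theta> m t))\<^sup>2) (at t within {0..1})"
        "(\<Theta> m' has_real_derivative (sin (\<Theta> m' t))\<^sup>2 + m' * a t * (cos (\<Theta> m' t))\<^sup>2) (at t within {0..1})"
        using \<Theta> that by (auto simp: prufer_solution_def)
    qed (use \<Theta> that a b in \<open>auto simp: prufer_solution_def\<close>)
    then show ?thesis using N that by simp
  qed
  have "N ` S \<subseteq> {..<N l}" using less ev by (auto simp: S_def)
  moreover have "inj_on N S"
  proof (rule inj_onI)
    fix m m' assume mm: "m \<in> S" "m' \<in> S" "N m = N m'"
    show "m = m'"
      using less[of m m'] less[of m' m] mm by (cases m m' rule: linorder_cases) (auto simp: S_def)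
  qed
  ultimately have "k \<le> N l" using S card_inj_on_le[of N S "{..<N l}"] by simp
  then have "k * pi \<le> \<Theta> l 1" using N[OF ev] by simp
  with \<Theta>[OF ev] show ?thesis by blast
qed

section \<open>Nodal points\<close>

text \<open>Between consecutive points the sign condition excludes zeros of \<open>u - u0\<close>.
  Number and position of the points are therefore determined by \<open>u\<close>, which settles the
  word "exactly".\<close>

lemma nodal_points_zeros:
  assumes np: "nodal_points rel u0 u n x" and irrefl: "\<not> rel 0 0"
  shows "{t \<in> {0<..<1}. u t = u0} = x ` {1..n}"
proof
  have x0: "x 0 = 0" and x1: "x (n + 1) = 1" and mono: "strict_mono_on {0..n + 1} x"
    and sign: "\<And>i t. i \<in> {0..n} \<Longrightarrow> t \<in> {x i<..<x (i + 1)} \<Longrightarrow> rel ((-1) ^ (i + 1) * (u t - u0)) 0"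
    and zero: "\<And>i. i \<in> {1..n} \<Longrightarrow> u (x i) = u0"
    using np unfolding nodal_points_def by blast+
  show "x ` {1..n} \<subseteq> {t \<in> {0<..<1}. u t = u0}"
  proof (rule image_subsetI)
    fix i assume i: "i \<in> {1..n}"
    have "x 0 < x i" "x i < x (n + 1)"
      using i by (auto intro!: strict_mono_onD[OF mono])
    then show "x i \<in> {t \<in> {0<..<1}. u t = u0}" using x0 x1 zero[OF i] by simp
  qed
  show "{t \<in> {0<..<1}. u t = u0} \<subseteq> x ` {1..n}"
  proof safe
    fix t assume t: "t \<in> {0<..<1::real}" and ut: "u0 = u t"
    define I where "I = {i \<in> {0..n}. x i \<le> t}"
    have I: "finite I" "0 \<in> I" using t x0 by (auto simp: I_def)
    define i where "i = Max I"
    have "i \<in> I" unfolding i_def using I by (intro Max_in) auto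
    then have i: "i \<in> {0..n}" "x i \<le> t" by (auto simp: I_def)
    have lt: "t < x (i + 1)"
    proof (cases "i = n")
      case False
      show ?thesis
      proof (rule ccontr)
        assume "\<not> t < x (i + 1)"
        then have "i + 1 \<in> I" using False i by (auto simp: I_def)
        then have "i + 1 \<le> i" unfolding i_def using I by (intro Max_ge)
        then show False by simp
      qed
    qed (use t x1 in simp)
    have "x i = t"
    proof (rule ccontr)
      assume "x i \<noteq> t"
      then have "rel ((-1) ^ (i + 1) * (u t - u0)) 0" using i lt by (intro sign) auto
      then show False using irrefl ut by simp
    qed
    moreover have "i \<noteq> 0" using \<open>x i = t\<close> t x0 by (intro notI) simp
    ultimately show "t \<in> x ` {1..n}" using i by (intro image_eqI[of _ _ i]) auto
  qed
qed

lemma nodal_points_card: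
  assumes np: "nodal_points rel u0 u n x" and irrefl: "\<not> rel 0 0"
  shows "finite {t \<in> {0<..<1}. u t = u0}" "card {t \<in> {0<..<1}. u t = u0} = n"
proof -
  have "strict_mono_on {0..n + 1} x" using np unfolding nodal_points_def by blast
  then have "inj_on x {0..n + 1}" by (rule strict_mono_on_imp_inj_on)
  then have "inj_on x {1..n}" by (rule inj_on_subset) auto
  then show "finite {t \<in> {0<..<1}. u t = u0}" "card {t \<in> {0<..<1}. u t = u0} = n"
    unfolding nodal_points_zeros[OF assms] by (auto simp: card_image)
qed

lemma nodal_points_unique:
  assumes x: "nodal_points rel u0 u n x" and y: "nodal_points rel u0 u m y" and irrefl: "\<not> rel 0 0"
  shows "m = n \<and> (\<forall>i\<in>{0..n + 1}. y i = x i)"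
proof -
  have mn: "m = n" using nodal_points_card[OF x irrefl] nodal_points_card[OF y irrefl] by simp
  have mono: "strict_mono_on {0..n + 1} x" "strict_mono_on {0..n + 1} y"
    and ends: "x 0 = 0" "y 0 = 0" "x (n + 1) = 1" "y (n + 1) = 1"
    using x y mn unfolding nodal_points_def by blast+
  have sorted: "sorted (map z [1..<n + 1])" "distinct (map z [1..<n + 1])"
    if "strict_mono_on {0..n + 1} z" for z :: "nat \<Rightarrow> real"
  proof -
    have "strict_mono_on {1..n} z" using that by (auto simp: strict_mono_on_def)
    then show "distinct (map z [1..<n + 1])"
      by (simp add: distinct_map atLeastLessThanSuc_atLeastAtMost strict_mono_on_imp_inj_on del: upt_Suc)
    show "sorted (map z [1..<n + 1])"
      using that by (auto simp: sorted_iff_nth_mono_less strict_mono_on_def simp del: upt_Suc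
          intro!: less_imp_le)
  qed
  have "set (map x [1..<n + 1]) = set (map y [1..<n + 1])"
    using nodal_points_zeros[OF x irrefl] nodal_points_zeros[OF y irrefl] mn
    by (simp add: atLeastLessThanSuc_atLeastAtMost del: upt_Suc)
  then have "map x [1..<n + 1] = map y [1..<n + 1]"
    by (intro sorted_distinct_set_unique sorted mono)
  then have eq: "x i = y i" if "i \<in> {1..n}" for i
    using that by (simp add: map_eq_conv atLeastLessThanSuc_atLeastAtMost del: upt_Suc)
  have "y i = x i" if "i \<in> {0..n + 1}" for i
  proof -
    have "i = 0 \<or> i = n + 1 \<or> i \<in> {1..n}" using that by auto
    then show ?thesis using ends eq[of i] by auto
  qed
  with mn show ?thesis by blast
qed

lemma exactly_nodal_points_iff:
  assumes "\<not> rel 0 0"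
  shows "exactly_nodal_points rel u0 u n \<longleftrightarrow> (\<exists>x. nodal_points rel u0 u n x)"
  unfolding exactly_nodal_points_def using nodal_points_unique[of rel u0 u] assms by blast

text \<open>The number of interior zeros of \<open>u - u0\<close> depends only on the values on
  \<open>{0..1}\<close>, so it separates the members of a family.\<close>

lemma exactly_nodal_points_distinct:
  assumes "exactly_nodal_points rel u0 u m" "exactly_nodal_points rel u0 v n" "m \<noteq> n" "\<not> rel 0 0"
  shows "\<exists>t\<in>{0..1}. u t \<noteq> v t"
proof (rule ccontr)
  assume "\<not> (\<exists>t\<in>{0..1}. u t \<noteq> v t)"
  then have "{t \<in> {0<..<1}. u t = u0} = {t \<in> {0<..<1}. v t = u0}" by auto
  then show False
    using assms nodal_points_card(2)[of rel u0] unfolding exactly_nodal_points_def by metis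
qed

text \<open>For a constant function \<open>u - u0\<close> has no zero in the open interval or
  infinitely many, never a positive finite number.\<close>

lemma exactly_nodal_points_not_constant:
  assumes "exactly_nodal_points rel u0 u n" "n \<ge> 1" "\<not> rel 0 0"
  shows "\<not> u constant_on {0..1}"
proof
  assume "u constant_on {0..1}"
  then obtain c where c: "\<And>t. t \<in> {0..1} \<Longrightarrow> u t = c" unfolding constant_on_def by blast
  let ?Z = "{t \<in> {0<..<1}. u t = u0}"
  have Z: "finite ?Z" "card ?Z = n"
    using assms nodal_points_card[of rel u0 u n] unfolding exactly_nodal_points_def by blast+
  have "?Z \<noteq> {}" using Z(2) assms(2) by (metis card.empty not_one_le_zero)
  then obtain t where "t \<in> ?Z" by blast
  then have "c = u0" using c[of t] by simp
  then have "s \<in> ?Z" if "s \<in> {0<..<1}" for s using c[of s] that by simp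
  then have "{0<..<1} \<subseteq> ?Z" by blast
  then have "finite {0<..<1::real}" using Z(1) by (rule finite_subset)
  then show False using infinite_Ioo[of 0 "1::real"] by simp
qed

text \<open>The angle sweeps \<open>{0..n * pi}\<close> once, so \<open>cos \<theta>\<close> changes
  sign exactly at the \<open>n\<close> odd multiples of \<open>pi / 2\<close> in that range; the
  times at which these are attained are the interior nodal points. The sign of
  \<open>\<sigma>\<close> records the side of \<open>u0\<close> on which \<open>u\<close>
  starts.\<close>

lemma rotating_nodal_points:
  fixes u u1 u2 \<theta> :: "real \<Rightarrow> real" and \<sigma> :: real
  assumes u: "\<And>t. t \<in> {0..1} \<Longrightarrow> (u has_real_derivative u1 t) (at t within {0..1})"
    and u1: "\<And>t. t \<in> {0..1} \<Longrightarrow> (u1 has_real_derivative u2 t) (at t within {0..1})"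
    and u2: "continuous_on {0..1} u2" and bc: "u1 0 = 0" "u1 1 = 0"
    and \<theta>: "continuous_on {0..1} \<theta>" "strict_mono_on {0..1} \<theta>" "\<theta> 0 = 0" "\<theta> 1 = n * pi"
    and n: "n \<ge> 1"
    and polar: "\<And>t. t \<in> {0..1} \<Longrightarrow> \<exists>r>0. u t - u0 = \<sigma> * r * cos (\<theta> t)"
    and \<sigma>: "\<sigma> \<noteq> 0" and rel: "\<And>s. rel s 0 \<longleftrightarrow> s * \<sigma> < 0"
  shows "\<exists>x. nodal_points rel u0 u n x"
proof -
  \<comment> \<open>The extreme levels \<open>0\<close> and \<open>n * pi\<close> replace the values
    \<open>- pi / 2\<close> and \<open>(n + 1 / 2) * pi\<close> of the general formula, because the
    angle starts and stops there.\<close>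
  define T where "T i = (if i = 0 then 0 else if i = n + 1 then n * pi else (real i - 1 / 2) * pi)"
    for i :: nat
  have T_ends: "T 0 = 0" "T (n + 1) = n * pi" by (auto simp: T_def)
  have T_lower: "(real i - 1 / 2) * pi \<le> T i" if "i \<le> n" for i
    using that by (auto simp: T_def)
  have T_upper: "T (i + 1) \<le> (real i + 1 / 2) * pi" for i
    by (auto simp: T_def algebra_simps)
  have T_mono: "T i < T (Suc i)" if "i \<le> n" for i
    using that n pi_gt_zero by (auto simp: T_def algebra_simps)
  have T_less: "T i < T j" if "i < j" "j \<le> n + 1" for i j
    using that by (induction j) (auto simp: less_Suc_eq intro: T_mono less_trans[OF _ T_mono])
  have "\<exists>t\<in>{0..1}. \<theta> t = T i" if "i \<le> n + 1" for i
  proof -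
    have "T 0 \<le> T i" "T i \<le> T (n + 1)"
      using that T_less[of 0 i] T_less[of i "n + 1"] by (cases "i = 0"; cases "i = n + 1"; force)+
    then have "\<theta> 0 \<le> T i" "T i \<le> \<theta> 1" using \<theta> T_ends by auto
    from IVT'[OF this _ \<theta>(1)] show ?thesis by auto
  qed
  then obtain x where x: "\<And>i. i \<le> n + 1 \<Longrightarrow> x i \<in> {0..1} \<and> \<theta> (x i) = T i" by metis
  have \<theta>_less: "s < t \<longleftrightarrow> \<theta> s < \<theta> t" if "s \<in> {0..1}" "t \<in> {0..1}" for s t
    using strict_mono_on_less[OF \<theta>(2) that] by simp
  have \<theta>_inj: "s = t" if "\<theta> s = \<theta> t" "s \<in> {0..1}" "t \<in> {0..1}" for s t
    using \<theta>_less[of s t] \<theta>_less[of t s] that by auto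
  have x_less: "x i < x j" if "i < j" "j \<le> n + 1" for i j
    using \<theta>_less[of "x i" "x j"] x[of i] x[of j] T_less[OF that] that by auto
  have x0: "x 0 = 0" by (rule \<theta>_inj) (use x[of 0] \<theta>(3) T_ends in simp_all)
  have x1: "x (n + 1) = 1" by (rule \<theta>_inj) (use x[of "n + 1"] \<theta>(4) T_ends in simp_all)
  note ends = x0 x1
  \<comment> \<open>Two distinct points \<open>p < q\<close> of the interval ensure that all its
    points are limit points, so that relative derivatives are unique.\<close>
  have C2: "Ck_on 2 I u" if "I \<subseteq> {0..1}" "connected I" "p \<in> I" "q \<in> I" "p < q" for I p q
  proof (rule Ck_on_2I[of _ _ u1 u2])
    fix t assume "t \<in> I"
    then show "(u has_real_derivative u1 t) (at t within I)"
      "(u1 has_real_derivative u2 t) (at t within I)" "t islimpt I"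
      using that u u1 has_field_derivative_subset islimpt_interval_real[OF that(2-5)] by blast+
  qed (use u2 that continuous_on_subset in blast)
  have C2': "Ck_on 2 {x i<..<x j} u" if "i < j" "j \<le> n + 1" for i j
  proof (rule C2[of _ "(2 * x i + x j) / 3" "(x i + 2 * x j) / 3"])
    have "x i \<in> {0..1}" "x j \<in> {0..1}" "x i < x j"
      using x_less[OF that] x[of i] x[of j] that by simp_all
    then show "{x i<..<x j} \<subseteq> {0..1}" "(2 * x i + x j) / 3 \<in> {x i<..<x j}"
      "(x i + 2 * x j) / 3 \<in> {x i<..<x j}" "(2 * x i + x j) / 3 < (x i + 2 * x j) / 3"
      by auto
  qed simp
  have d: "deriv_on {0..1} u t = u1 t" if "t \<in> {0..1}" for t
    using deriv_on_eqI[OF u[OF that] islimpt_interval_real[of "{0..1}" 0 1 t]] that by simp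
  have "x 0 < x 1" "x n < x (n + 1)" by (intro x_less; simp)+
  then have C2e: "Ck_on 2 {0..<x 1} u" "Ck_on 2 {x n<..1} u"
    using ends x[of 1] x[of n]
    by (intro C2[of "{0..<x 1}" 0 "x 1 / 2"] C2[of "{x n<..1}" "(x n + 1) / 2" 1]; auto)+
  have sign: "rel ((-1) ^ (i + 1) * (u t - u0)) 0" if i: "i \<in> {0..n}" and t: "t \<in> {x i<..<x (i + 1)}" for i t
  proof -
    have t01: "t \<in> {0..1}" using t x[of i] x[of "i + 1"] i by auto
    have "T i < \<theta> t" "\<theta> t < T (i + 1)"
      using \<theta>_less[of "x i" t] \<theta>_less[of t "x (i + 1)"] x[of i] x[of "i + 1"] i t t01 by auto
    then have "(real i - 1 / 2) * pi < \<theta> t" "\<theta> t < (real i + 1 / 2) * pi"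
      using T_lower[of i] T_upper[of i] i by auto
    \<comment> \<open>Subtracting \<open>i * pi\<close> moves the angle into
      \<open>{- pi / 2<..<pi / 2}\<close>, where the cosine is positive; this is the origin of the
      alternating sign.\<close>
    then have "0 < cos (\<theta> t - i * pi)" by (intro cos_gt_zero_pi) (auto simp: algebra_simps)
    then have c: "0 < (-1) ^ i * cos (\<theta> t)" by (simp add: cos_diff mult.commute)
    obtain r where r: "r > 0" "u t - u0 = \<sigma> * r * cos (\<theta> t)" using polar[OF t01] by blast
    have "(-1) ^ (i + 1) * (u t - u0) * \<sigma> = - (\<sigma>\<^sup>2 * r * ((-1) ^ i * cos (\<theta> t)))"
      unfolding r by (simp add: power2_eq_square)
    also have "\<dots> < 0" using \<sigma> r c by simp
    finally show ?thesis by (simp add: rel)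
  qed
  have zero: "u (x i) = u0" if i: "i \<in> {1..n}" for i
  proof -
    have "cos (\<theta> (x i)) = 0"
    proof -
      have "\<theta> (x i) = i * pi - pi / 2" using x[of i] i by (auto simp: T_def algebra_simps)
      then show ?thesis by (simp add: cos_diff)
    qed
    then show ?thesis using polar[of "x i"] x[of i] i by auto
  qed
  have "nodal_points rel u0 u n x"
    unfolding nodal_points_def
  proof (intro conjI ballI)
    show "strict_mono_on {0..n + 1} x" by (auto intro!: strict_mono_onI x_less)
  qed (use ends C2e C2' d bc sign zero in auto)
  then show ?thesis by blast
qed

section \<open>Shooting\<close>

lemma continuous_deriv_lipschitz:
  fixes h :: "real \<Rightarrow> real"
  assumes h: "\<And>s. s \<in> {p..q} \<Longrightarrow> (h has_real_derivative h' s) (at s within {p..q})"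
    and h': "continuous_on {p..q} h'"
  shows "\<exists>L>0. \<forall>s\<in>{p..q}. \<forall>t\<in>{p..q}. \<bar>h s - h t\<bar> \<le> L * \<bar>s - t\<bar>"
proof -
  have "bounded (h' ` {p..q})"
    by (intro compact_imp_bounded compact_continuous_image h' compact_Icc)
  then obtain L where L: "L > 0" "\<And>s. s \<in> {p..q} \<Longrightarrow> \<bar>h' s\<bar> \<le> L"
    unfolding bounded_pos by auto
  have "\<bar>h s - h t\<bar> \<le> L * \<bar>s - t\<bar>" if "s \<in> {p..q}" "t \<in> {p..q}" for s t
    using field_differentiable_bound[of "{p..q}" h h' L s t] h L(2) that by simp
  with L(1) show ?thesis by blast
qed

definition clamp_to :: "real \<Rightarrow> real \<Rightarrow> real \<Rightarrow> real" where
  "clamp_to p q s = max p (min q s)"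

lemma clamp_to_in [simp]: "p \<le> q \<Longrightarrow> clamp_to p q s \<in> {p..q}"
  and clamp_to_id: "s \<in> {p..q} \<Longrightarrow> clamp_to p q s = s"
  and clamp_to_dist: "\<bar>clamp_to p q s - clamp_to p q t\<bar> \<le> \<bar>s - t\<bar>"
  by (auto simp: clamp_to_def)

lemma clamp_comp_lipschitz:
  fixes h :: "real \<Rightarrow> real"
  assumes h: "\<And>s. s \<in> {p..q} \<Longrightarrow> (h has_real_derivative h' s) (at s within {p..q})"
    and h': "continuous_on {p..q} h'" and pq: "p \<le> q"
  shows "\<exists>L>0. \<forall>s t. \<bar>h (clamp_to p q s) - h (clamp_to p q t)\<bar> \<le> L * \<bar>s - t\<bar>"
proof -
  from continuous_deriv_lipschitz[OF h h'] obtain L where L: "L > 0"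
    "\<And>s t. s \<in> {p..q} \<Longrightarrow> t \<in> {p..q} \<Longrightarrow> \<bar>h s - h t\<bar> \<le> L * \<bar>s - t\<bar>" by blast
  have "\<bar>h (clamp_to p q s) - h (clamp_to p q t)\<bar> \<le> L * \<bar>s - t\<bar>" for s t
  proof -
    have "\<bar>h (clamp_to p q s) - h (clamp_to p q t)\<bar> \<le> L * \<bar>clamp_to p q s - clamp_to p q t\<bar>"
      using pq by (intro L(2) clamp_to_in)
    also have "\<dots> \<le> L * \<bar>s - t\<bar>" using L(1) by (intro mult_left_mono clamp_to_dist) auto
    finally show ?thesis .
  qed
  with L(1) show ?thesis by blast
qed

lemma continuous_antiderivative_real:
  fixes h :: "real \<Rightarrow> real"
  assumes "continuous_on UNIV h"
  shows "\<exists>H. H p = 0 \<and> (\<forall>s. (H has_real_derivative h s) (at s))"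
proof -
  have "\<exists>H. \<forall>s. -\<infinity> < ereal s \<longrightarrow> ereal s < \<infinity> \<longrightarrow> (H has_vector_derivative h s) (at s)"
    using assms by (intro einterval_antiderivative) (auto simp: continuous_on_eq_continuous_at)
  then obtain H where "\<And>s. (H has_real_derivative h s) (at s)"
    by (auto simp: has_real_derivative_iff_has_vector_derivative)
  then show ?thesis
    by (intro exI[of _ "\<lambda>s. H s - H p"]) (auto intro!: derivative_eq_intros)
qed

text \<open>Recovers \<open>u'\<close> from \<open>w = u' / sqrt (1 + u'\<^sup>2)\<close>; it is
  singular at \<open>\<bar>w\<bar> = 1\<close>, which corresponds to an infinite slope.\<close>

abbreviation slope_of :: "real \<Rightarrow> real" where
  "slope_of w \<equiv> w / sqrt (1 - w\<^sup>2)"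

lemma slope_of_deriv:
  assumes "\<bar>w\<bar> < 1"
  shows "(slope_of has_real_derivative 1 / ((1 - w\<^sup>2) * sqrt (1 - w\<^sup>2))) (at w)"
proof -
  have "w\<^sup>2 < 1" using assms by (simp add: abs_square_less_1)
  then show ?thesis
    by (auto intro!: derivative_eq_intros simp: field_simps power2_eq_square)
qed

text \<open>
  With \<open>w = u' / sqrt (1 + u'\<^sup>2)\<close> the state is \<open>z = (u - u0) - \<i> w\<close>; the sign of the imaginary
  part makes the polar angle increase. The function \<open>g\<close> is the inverse of
  \<open>s \<mapsto> s / sqrt (1 + s\<^sup>2)\<close>, cut off at \<open>\<bar>w\<bar> = d\<close>, and \<open>\<phi>\<close> will be \<open>f\<close> cut off outside a
  compact interval. Neither truncation is active on the solutions of interest.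
\<close>
locale shooting =
  fixes a a' \<phi> F :: "real \<Rightarrow> real" and u0 d Lp :: real
  assumes a_deriv: "t \<in> {0..1} \<Longrightarrow> (a has_real_derivative a' t) (at t within {0..1})"
    and a'_cont: "continuous_on {0..1} a'"
    and a_pos: "t \<in> {0..1} \<Longrightarrow> 0 < a t"
    and \<phi>_lip: "\<bar>\<phi> s - \<phi> t\<bar> \<le> Lp * \<bar>s - t\<bar>"
    and \<phi>_nonpos: "s \<le> 0 \<Longrightarrow> \<phi> s = 0"
    and \<phi>_neg: "0 < s \<Longrightarrow> s < u0 \<Longrightarrow> \<phi> s < 0"
    and \<phi>_u0: "\<phi> u0 = 0"
    and \<phi>_pos: "u0 < s \<Longrightarrow> 0 < \<phi> s"
    and F_deriv: "(F has_real_derivative \<phi> s) (at s)"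
    and F_u0: "F u0 = 0"
    and u0: "0 < u0" and d: "0 < d" "d < 1"
begin

lemma a_cont: "continuous_on {0..1} a"
  by (rule DERIV_continuous_on) (rule a_deriv)

lemma \<phi>_cont: "continuous_on S \<phi>"
proof -
  have "0 \<le> \<bar>\<phi> 1 - \<phi> 0\<bar>" by simp
  also have "\<dots> \<le> Lp * \<bar>1 - 0\<bar>" by (rule \<phi>_lip)
  finally have "Lp \<ge> 0" by simp
  then have "Lp-lipschitz_on S \<phi>"
    by (intro lipschitz_onI) (auto simp: dist_real_def \<phi>_lip)
  then show ?thesis by (rule lipschitz_on_continuous_on)
qed

lemma \<phi>_sign: "0 \<le> \<phi> s * (s - u0)"
  using \<phi>_nonpos[of s] \<phi>_neg[of s] \<phi>_pos[of s] \<phi>_u0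
  by (cases "s \<le> 0"; cases "s < u0"; cases "s = u0") (auto simp: mult_nonpos_nonpos)

text \<open>On the nonpositive half-line \<open>\<phi>\<close> vanishes, so strictness needs
  \<open>0 < s\<close>. For this reason positivity of the solution enters the strict growth of the
  angle.\<close>

lemma \<phi>_sign_strict: "0 < s \<Longrightarrow> s \<noteq> u0 \<Longrightarrow> 0 < \<phi> s * (s - u0)"
  using \<phi>_neg[of s] \<phi>_pos[of s] by (cases "s < u0") (auto simp: mult_neg_neg)

text \<open>Together with \<open>F_antimono\<close>: \<open>F\<close> has its minimum at
  \<open>u0\<close>, and an initial value closer to \<open>u0\<close> on the same side carries no
  more energy.\<close>

lemma F_mono:
  assumes "u0 \<le> s" "s \<le> t"
  shows "F s \<le> F t"
proof (rule DERIV_nonneg_imp_nondecreasing[OF assms(2)])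
  fix x assume "s \<le> x"
  then have "0 \<le> \<phi> x" using \<phi>_pos[of x] \<phi>_u0 assms by (cases "x = u0") auto
  with F_deriv show "\<exists>y. (F has_real_derivative y) (at x) \<and> 0 \<le> y" by blast
qed

lemma F_antimono:
  assumes "s \<le> t" "t \<le> u0"
  shows "F t \<le> F s"
proof (rule DERIV_nonpos_imp_nonincreasing[OF assms(1)])
  fix x assume "x \<le> t"
  then have "\<phi> x \<le> 0"
    using \<phi>_neg[of x] \<phi>_nonpos[of x] \<phi>_u0 assms by (cases "x = u0"; cases "x \<le> 0") auto
  with F_deriv show "\<exists>y. (F has_real_derivative y) (at x) \<and> y \<le> 0" by blast
qed

lemma F_nonneg: "0 \<le> F s"
  using F_mono[of u0 s] F_antimono[of s u0] F_u0 by (cases "u0 \<le> s") auto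

section \<open>The truncated slope function\<close>

definition g :: "real \<Rightarrow> real" where
  "g s = slope_of (clamp_to (- d) d s)"

lemma sqrt_d: "0 < sqrt (1 - d\<^sup>2)"
  using d by (simp add: abs_square_less_1)

lemma g_lip: "\<exists>L>0. \<forall>s t. \<bar>g s - g t\<bar> \<le> L * \<bar>s - t\<bar>"
  unfolding g_def
proof (rule clamp_comp_lipschitz)
  have less: "s\<^sup>2 < 1" if "s \<in> {- d..d}" for s
    using that d by (auto simp: abs_square_less_1 abs_less_iff)
  have nz: "(1 - s\<^sup>2) * sqrt (1 - s\<^sup>2) \<noteq> 0" if "s \<in> {- d..d}" for s
    using less[OF that] by simp
  show "continuous_on {- d..d} (\<lambda>s. 1 / ((1 - s\<^sup>2) * sqrt (1 - s\<^sup>2)))"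
    by (intro continuous_on_divide continuous_intros ballI nz)
  show "(slope_of has_real_derivative 1 / ((1 - s\<^sup>2) * sqrt (1 - s\<^sup>2))) (at s within {- d..d})"
    if "s \<in> {- d..d}" for s
    by (rule has_field_derivative_at_within[OF slope_of_deriv]) (use that d in auto)
qed (use d in simp)

lemma g_cont: "continuous_on S g"
proof -
  from g_lip obtain L where "L > 0" "\<And>s t. \<bar>g s - g t\<bar> \<le> L * \<bar>s - t\<bar>" by blast
  then have "L-lipschitz_on S g" by (intro lipschitz_onI) (auto simp: dist_real_def)
  then show ?thesis by (rule lipschitz_on_continuous_on)
qed

lemma g_eq: "\<bar>s\<bar> \<le> d \<Longrightarrow> g s = slope_of s"
  using clamp_to_id[of s "- d" d] by (simp add: g_def abs_le_iff)

lemma g_0 [simp]: "g 0 = 0"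
  using d by (simp add: g_eq)

lemma clamp_sq_le: "(clamp_to (- d) d s)\<^sup>2 \<le> d\<^sup>2"
  using clamp_to_in[of "- d" d s] d by (auto simp: abs_le_square_iff[symmetric] abs_le_iff)

lemma g_pos: "0 < s \<Longrightarrow> 0 < g s" and g_neg: "s < 0 \<Longrightarrow> g s < 0"
proof -
  have "0 < sqrt (1 - (clamp_to (- d) d s)\<^sup>2)"
    using clamp_sq_le[of s] sqrt_d by simp
  then show "0 < s \<Longrightarrow> 0 < g s" "s < 0 \<Longrightarrow> g s < 0"
    unfolding g_def using d by (auto simp: clamp_to_def max_def min_def divide_less_0_iff)
qed

lemma g_eq_0_iff [simp]: "g s = 0 \<longleftrightarrow> s = 0"
  using g_pos[of s] g_neg[of s] by (cases s "0::real" rule: linorder_cases) auto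

lemma g_sign: "s \<noteq> 0 \<Longrightarrow> 0 < g s * s"
  using g_pos[of s] g_neg[of s] by (cases "0 < s") (auto simp: mult_neg_neg)

lemma g_sign': "0 \<le> g s * s"
  using g_sign[of s] by (cases "s = 0") auto

text \<open>Dividing by \<open>sqrt (1 - s\<^sup>2) \<le> 1\<close> can only enlarge the modulus, so
  the nonlinear equation turns at least as fast as the linear one. Beyond the cutoff
  \<open>g\<close> is constant and the estimate fails for large \<open>s\<close>.\<close>

lemma g_ge: "\<bar>s\<bar> \<le> d \<Longrightarrow> s\<^sup>2 \<le> g s * s"
proof -
  assume s: "\<bar>s\<bar> \<le> d"
  then have "s\<^sup>2 \<le> d\<^sup>2" by (metis abs_ge_zero abs_le_square_iff abs_of_nonneg order_trans)
  then have "0 < sqrt (1 - s\<^sup>2)" "sqrt (1 - s\<^sup>2) \<le> 1" using sqrt_d by auto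
  then have "s\<^sup>2 * 1 \<le> s\<^sup>2 * (1 / sqrt (1 - s\<^sup>2))" by (intro mult_left_mono) auto
  then show "s\<^sup>2 \<le> g s * s" using s by (simp add: g_eq power2_eq_square)
qed

lemma g_bound: "\<bar>g s\<bar> \<le> slope_of d"
proof -
  have "\<bar>clamp_to (- d) d s\<bar> \<le> d" using clamp_to_in[of "- d" d s] d by (auto simp: abs_le_iff)
  then show ?thesis unfolding g_def abs_divide
    using clamp_sq_le[of s] sqrt_d by (intro frac_le) auto
qed

section \<open>The truncated planar system and its flow\<close>

definition field :: "real \<Rightarrow> complex \<Rightarrow> complex" where
  "field t z = Complex (- g (Im z)) (a t * \<phi> (u0 + Re z))"

lemma field_0 [simp]: "field t 0 = 0"
  by (simp add: field_def \<phi>_u0 complex_eq_iff)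

lemma field_lip: "\<exists>K>0. \<forall>t\<in>{0..1}. \<forall>z w. norm (field t z - field t w) \<le> K * norm (z - w)"
proof -
  from g_lip obtain L where L: "L > 0" "\<And>s t. \<bar>g s - g t\<bar> \<le> L * \<bar>s - t\<bar>" by blast
  obtain b where b: "\<And>t. t \<in> {0..1} \<Longrightarrow> a t \<le> b"
    using continuous_attains_sup[OF compact_Icc _ a_cont]
    by (metis atLeastAtMost_iff empty_iff order_refl zero_le_one)
  have b0: "0 < b" using b[of 0] a_pos[of 0] by auto
  have Lp: "0 \<le> Lp" using \<phi>_lip[of 1 0] abs_ge_zero[of "\<phi> 1 - \<phi> 0"] by simp
  have "norm (field t z - field t w) \<le> (L + b * Lp) * norm (z - w)" if t: "t \<in> {0..1}" for t z w
  proof -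
    have "norm (field t z - field t w)
        \<le> \<bar>g (Im w) - g (Im z)\<bar> + a t * \<bar>\<phi> (u0 + Re z) - \<phi> (u0 + Re w)\<bar>"
      using cmod_le[of "field t z - field t w"] a_pos[OF t]
      by (simp add: field_def abs_mult flip: right_diff_distrib)
    also have "\<dots> \<le> L * \<bar>Im w - Im z\<bar> + b * (Lp * \<bar>(u0 + Re z) - (u0 + Re w)\<bar>)"
      using a_pos[OF t] b[OF t] by (intro add_mono mult_mono L \<phi>_lip) auto
    also have "\<dots> \<le> L * norm (z - w) + b * (Lp * norm (z - w))"
      using abs_Re_le_cmod[of "z - w"] abs_Im_le_cmod[of "z - w"] L b0 Lp
      by (intro add_mono mult_left_mono) (auto simp: abs_minus_commute)
    finally show ?thesis by (simp add: algebra_simps)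
  qed
  moreover have "L + b * Lp > 0" using L b0 Lp by (simp add: add_pos_nonneg)
  ultimately show ?thesis by blast
qed

definition K :: real where
  "K = (SOME K. K > 0 \<and> (\<forall>t\<in>{0..1}. \<forall>z w. norm (field t z - field t w) \<le> K * norm (z - w)))"

lemma K_pos: "0 < K"
  and field_lipschitz: "t \<in> {0..1} \<Longrightarrow> norm (field t z - field t w) \<le> K * norm (z - w)"
  using someI_ex[OF field_lip[unfolded Bex_def]] unfolding K_def by blast+

lemma field_norm: "t \<in> {0..1} \<Longrightarrow> norm (field t z) \<le> K * norm z"
  using field_lipschitz[of t z 0] by simp

lemma field_cont: "continuous_on {0..1} z \<Longrightarrow> continuous_on {0..1} (\<lambda>t. field t (z t))"
  unfolding field_def Complex_eq
  by (intro continuous_intros a_cont continuous_on_compose2[OF g_cont[of UNIV]]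
      continuous_on_compose2[OF \<phi>_cont[of UNIV]]) auto

text \<open>The shooting parameter \<open>c\<close> is \<open>u 0\<close>, and the real initial
  state encodes \<open>u' 0 = 0\<close>. As \<open>g\<close> is odd and \<open>Im z = - w\<close>,
  the field expresses \<open>u' = g w\<close> and \<open>w' = - a * \<phi> u\<close>.\<close>

definition sol :: "real \<Rightarrow> real \<Rightarrow> complex" where
  "sol c = (SOME z. z 0 = of_real (c - u0) \<and>
    (\<forall>t\<in>{0..1}. (z has_vector_derivative field t (z t)) (at t within {0..1})))"

lemma sol_0 [simp]: "sol c 0 = of_real (c - u0)"
  and sol_deriv: "t \<in> {0..1} \<Longrightarrow> (sol c has_vector_derivative field t (sol c t)) (at t within {0..1})"
  using someI_ex[OF lipschitz_ivp_solution[OF field_cont field_lipschitz K_pos, of "of_real (c - u0)"]]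
  unfolding sol_def by blast+

lemma sol_cont: "continuous_on {0..1} (sol c)"
  using sol_deriv has_vector_derivative_continuous continuous_on_eq_continuous_within by blast

lemma Re_sol_deriv:
  "t \<in> {0..1} \<Longrightarrow> ((\<lambda>t. Re (sol c t)) has_real_derivative - g (Im (sol c t))) (at t within {0..1})"
  and Im_sol_deriv:
  "t \<in> {0..1} \<Longrightarrow>
    ((\<lambda>t. Im (sol c t)) has_real_derivative a t * \<phi> (u0 + Re (sol c t))) (at t within {0..1})"
  using sol_deriv[of t c]
  by (simp_all add: has_vector_derivative_complex_iff field_def has_real_derivative_iff_has_vector_derivative)

lemma exp_K_le: "s \<in> {0..1} \<Longrightarrow> t \<in> {0..1} \<Longrightarrow> exp (K * \<bar>s - t\<bar>) \<le> exp K"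
  using K_pos mult_left_mono[of "\<bar>s - t\<bar>" 1 K] by auto

lemma sol_norm_le:
  assumes t: "t \<in> {0..1}"
  shows "norm (sol c t) \<le> \<bar>c - u0\<bar> * exp K"
proof -
  have "norm (sol c t) \<le> norm (sol c 0) * exp (K * \<bar>t - 0\<bar>)"
    using t by (intro gronwall_norm[OF sol_deriv field_norm]) auto
  also have "\<dots> \<le> norm (sol c 0) * exp K" using t by (intro mult_left_mono exp_K_le) auto
  finally show ?thesis by (simp add: norm_of_real del: of_real_diff)
qed

text \<open>Gronwall run from \<open>t\<close> back to \<open>0\<close>: a solution that starts off
  the equilibrium stays away from it, which makes its polar angle available.\<close>

lemma sol_norm_ge:
  assumes t: "t \<in> {0..1}"
  shows "\<bar>c - u0\<bar> \<le> norm (sol c t) * exp K"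
proof -
  have "norm (sol c 0) \<le> norm (sol c t) * exp (K * \<bar>0 - t\<bar>)"
    using t by (intro gronwall_norm[OF sol_deriv field_norm]) auto
  also have "\<dots> \<le> norm (sol c t) * exp K" using t by (intro mult_left_mono exp_K_le) auto
  finally show ?thesis by (simp add: norm_of_real del: of_real_diff)
qed

lemma sol_dist_le:
  assumes t: "t \<in> {0..1}"
  shows "norm (sol c t - sol e t) \<le> \<bar>c - e\<bar> * exp K"
proof -
  have "norm (sol c t - sol e t) \<le> norm (sol c 0 - sol e 0) * exp (K * \<bar>t - 0\<bar>)"
    using t by (intro gronwall_norm[OF has_vector_derivative_diff[OF sol_deriv sol_deriv] field_lipschitz]) auto
  also have "\<dots> \<le> norm (sol c 0 - sol e 0) * exp K" using t by (intro mult_left_mono exp_K_le) auto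
  also have "sol c 0 - sol e 0 = of_real (c - e)" by simp
  finally show ?thesis by (simp add: norm_of_real del: of_real_diff)
qed

section \<open>The rotation angle and its dependence on the initial value\<close>

definition angle :: "real \<Rightarrow> real \<Rightarrow> real" where
  "angle c = polar_angle (sol c) (\<lambda>t. field t (sol c t))"

lemma sol_nonvanishing: "c \<noteq> u0 \<Longrightarrow> nonvanishing_path (sol c) (\<lambda>t. field t (sol c t))"
proof unfold_locales
  show "sol c t \<noteq> 0" if "c \<noteq> u0" "t \<in> {0..1}" for t
    using sol_norm_ge[OF that(2), of c] that(1) by auto
qed (rule sol_deriv field_cont[OF sol_cont]; assumption?)+

lemma angle_0 [simp]: "angle c 0 = 0"
  by (simp add: angle_def)

lemma angle_deriv:
  assumes "c \<noteq> u0" "t \<in> {0..1}"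
  shows "(angle c has_real_derivative
    (a t * (\<phi> (u0 + Re (sol c t)) * Re (sol c t)) + g (Im (sol c t)) * Im (sol c t)) / (norm (sol c t))\<^sup>2)
    (at t within {0..1})"
proof -
  interpret nonvanishing_path "sol c" "\<lambda>t. field t (sol c t)" by (rule sol_nonvanishing[OF assms(1)])
  show ?thesis
    using polar_angle_deriv[OF assms(2)] unfolding Im_quot by (simp add: angle_def field_def mult.assoc)
qed

lemma angle_cont: "c \<noteq> u0 \<Longrightarrow> continuous_on {0..1} (angle c)"
  by (rule DERIV_continuous_on[OF angle_deriv])

lemma sol_polar:
  assumes "c \<noteq> u0" "t \<in> {0..1}"
  obtains r where "r > 0" "Re (sol c t) = (c - u0) * r * cos (angle c t)"
    "Im (sol c t) = (c - u0) * r * sin (angle c t)"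
proof -
  interpret nonvanishing_path "sol c" "\<lambda>t. field t (sol c t)" by (rule sol_nonvanishing[OF assms(1)])
  show ?thesis using polar_form[OF assms(2)] that by (auto simp: angle_def)
qed

lemma angle_squares:
  assumes "c \<noteq> u0" "t \<in> {0..1}"
  shows "(cos (angle c t))\<^sup>2 = (Re (sol c t))\<^sup>2 / (norm (sol c t))\<^sup>2"
    and "(sin (angle c t))\<^sup>2 = (Im (sol c t))\<^sup>2 / (norm (sol c t))\<^sup>2"
proof -
  interpret nonvanishing_path "sol c" "\<lambda>t. field t (sol c t)" by (rule sol_nonvanishing[OF assms(1)])
  show "(cos (angle c t))\<^sup>2 = (Re (sol c t))\<^sup>2 / (norm (sol c t))\<^sup>2"
    "(sin (angle c t))\<^sup>2 = (Im (sol c t))\<^sup>2 / (norm (sol c t))\<^sup>2"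
    using polar_angle_squares[OF assms(2)] by (auto simp: angle_def)
qed

text \<open>The difference of the quotients \<open>field t (sol t) / sol t\<close> is split so that
  the factor \<open>norm (sol e t)\<close> cancels. Only the lower bound for \<open>sol c\<close>
  enters, and the constant does not degenerate as \<open>e\<close> varies.\<close>

lemma angle_diff_le:
  assumes c: "c \<noteq> u0" and e: "e \<noteq> u0"
  shows "\<bar>angle e 1 - angle c 1\<bar> \<le> 2 * K * exp K * exp K / \<bar>c - u0\<bar> * \<bar>e - c\<bar>"
proof -
  interpret c: nonvanishing_path "sol c" "\<lambda>t. field t (sol c t)" by (rule sol_nonvanishing[OF c])
  interpret e: nonvanishing_path "sol e" "\<lambda>t. field t (sol e t)" by (rule sol_nonvanishing[OF e])
  let ?q = "\<lambda>t. field t (sol e t) / sol e t - field t (sol c t) / sol c t"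
  let ?B = "2 * K * exp K * exp K / \<bar>c - u0\<bar> * \<bar>e - c\<bar>"
  have "norm (?q t) \<le> ?B" if t: "t \<in> {0..1}" for t
  proof -
    let ?z = "sol c t" and ?w = "sol e t"
    have nz: "?z \<noteq> 0" "?w \<noteq> 0" using c.z_nz[OF t] e.z_nz[OF t] by auto
    have "?q t = (field t ?w - field t ?z) / ?z + field t ?w * (?z - ?w) / (?w * ?z)"
      using nz by (simp add: field_simps)
    then have "norm (?q t) \<le> norm ((field t ?w - field t ?z) / ?z)
        + norm (field t ?w * (?z - ?w) / (?w * ?z))"
      by (simp only: norm_triangle_ineq)
    also have "\<dots> = norm (field t ?w - field t ?z) / norm ?z
        + norm (field t ?w) * norm (?z - ?w) / (norm ?w * norm ?z)"
      by (simp only: norm_divide norm_mult)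
    also have "\<dots> \<le> (K * norm (?w - ?z)) / norm ?z
        + (K * norm ?w) * norm (?z - ?w) / (norm ?w * norm ?z)"
      by (intro add_mono divide_right_mono mult_right_mono field_lipschitz field_norm t) auto
    also have "\<dots> = 2 * K * norm (?w - ?z) / norm ?z"
      using nz by (simp add: field_simps norm_minus_commute)
    also have "\<dots> \<le> 2 * K * (\<bar>e - c\<bar> * exp K) / (\<bar>c - u0\<bar> / exp K)"
      using sol_dist_le[OF t, of e c] sol_norm_ge[OF t, of c] K_pos c
      by (intro frac_le mult_left_mono) (auto simp: field_simps)
    finally show ?thesis by (simp add: field_simps)
  qed
  then have "norm (integral {0..1} ?q) \<le> ?B * (1 - 0)"
    by (intro integral_bound continuous_on_diff c.quot_cont e.quot_cont) auto
  moreover have "integral {0..1} ?q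
      = integral {0..1} (\<lambda>t. field t (sol e t) / sol e t) - integral {0..1} (\<lambda>t. field t (sol c t) / sol c t)"
    by (intro Henstock_Kurzweil_Integration.integral_diff integrable_continuous_real c.quot_cont e.quot_cont)
  then have "Im (integral {0..1} ?q) = angle e 1 - angle c 1"
    by (simp add: angle_def polar_angle_def)
  ultimately have "\<bar>angle e 1 - angle c 1\<bar> \<le> ?B * (1 - 0)"
    using abs_Im_le_cmod[of "integral {0..1} ?q"] by (simp only:)
  then show ?thesis by simp
qed

lemma angle_cont_initial: "continuous_on (- {u0}) (\<lambda>c. angle c 1)"
proof -
  have "isCont (\<lambda>c. angle c 1) c" if c: "c \<noteq> u0" for c
  proof -
    let ?M = "2 * K * exp K * exp K / \<bar>c - u0\<bar>"
    have "\<forall>\<^sub>F e in at c. e \<noteq> u0" using c by (intro tendsto_imp_eventually_ne[of _ c]) auto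
    then have "\<forall>\<^sub>F e in at c. norm (angle e 1 - angle c 1) \<le> ?M * \<bar>e - c\<bar>"
      by eventually_elim (use angle_diff_le[OF c] in simp)
    moreover have "((\<lambda>e. ?M * \<bar>e - c\<bar>) \<longlongrightarrow> ?M * \<bar>c - c\<bar>) (at c)"
      by (rule tendsto_mult_left tendsto_rabs tendsto_diff tendsto_const tendsto_ident_at)+
    then have "((\<lambda>e. ?M * \<bar>e - c\<bar>) \<longlongrightarrow> 0) (at c)" by simp
    ultimately have "((\<lambda>e. angle e 1 - angle c 1) \<longlongrightarrow> 0) (at c)" by (rule Lim_null_comparison)
    then show ?thesis unfolding isCont_def by (simp add: LIM_zero_iff)
  qed
  then show ?thesis by (intro continuous_at_imp_continuous_on) auto
qed


section \<open>A priori bounds: energy and positivity\<close>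

text \<open>
  The energy inequality is applied with the primitive of the truncated \<open>g\<close>, so that the bound
  on \<open>Im (sol c t)\<close> follows without a continuation argument.
\<close>
lemma energy_bound:
  assumes c: "a 0 * exp (integral {0..1} (\<lambda>t. max (a' t) 0 / a t)) * F c \<le> 1 - sqrt (1 - d\<^sup>2)"
    and t: "t \<in> {0..1}"
  shows "\<bar>Im (sol c t)\<bar> \<le> d"
proof -
  from continuous_antiderivative_real[OF g_cont] obtain \<Gamma>
    where \<Gamma>_0: "\<Gamma> 0 = 0" and \<Gamma>: "\<And>s. (\<Gamma> has_real_derivative g s) (at s)" by blast
  have \<Gamma>_inc: "\<Gamma> s < \<Gamma> r" if "0 \<le> s" "s < r" for s r
    by (rule within_deriv_strict_mono[of s r \<Gamma> g, OF has_field_derivative_at_within[OF \<Gamma>]])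
      (use that g_pos in auto)
  have \<Gamma>_dec: "\<Gamma> s < \<Gamma> r" if "s \<le> 0" "r < s" for s r
  proof -
    have "- \<Gamma> r < - \<Gamma> s"
      by (rule within_deriv_strict_mono[of r s "\<lambda>x. - \<Gamma> x" "\<lambda>x. - g x",
            OF has_field_derivative_at_within[OF DERIV_minus[OF \<Gamma>]]])
        (use that g_neg in auto)
    then show ?thesis by simp
  qed
  \<comment> \<open>The explicit energy term is available inside the cutoff only; outside it the
    strict monotonicity of \<open>\<Gamma>\<close> on each half-line is enough.\<close>
  have \<Gamma>_eq: "\<Gamma> s = 1 - sqrt (1 - s\<^sup>2)" if s: "\<bar>s\<bar> \<le> d" for s
  proof -
    have "((\<lambda>s. \<Gamma> s + sqrt (1 - s\<^sup>2)) has_real_derivative 0) (at r within {- d..d})"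
      if r: "r \<in> {- d..d}" for r
    proof -
      have r: "\<bar>r\<bar> \<le> d" using r by auto
      then have "r\<^sup>2 < 1" using d by (simp add: abs_square_less_1)
      then have "((\<lambda>s. \<Gamma> s + sqrt (1 - s\<^sup>2)) has_real_derivative g r + - (r / sqrt (1 - r\<^sup>2))) (at r)"
        by (intro DERIV_add \<Gamma>) (auto intro!: derivative_eq_intros simp: field_simps)
      then show ?thesis using r by (simp add: g_eq has_field_derivative_at_within)
    qed
    then have "\<exists>k. \<forall>r\<in>{- d..d}. \<Gamma> r + sqrt (1 - r\<^sup>2) = k"
      by (intro has_field_derivative_zero_constant) auto
    then obtain k where k: "\<And>r. r \<in> {- d..d} \<Longrightarrow> \<Gamma> r + sqrt (1 - r\<^sup>2) = k" by blast
    show ?thesis using k[of 0] k[of s] s d \<Gamma>_0 by (auto simp: abs_le_iff)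
  qed
  define p where "p t = max (a' t) 0 / a t" for t
  have p_cont: "continuous_on {0..1} p"
    unfolding p_def by (intro continuous_intros a'_cont a_cont) (use a_pos in force)
  define P where "P t = integral {0..t} p" for t
  have P: "(P has_real_derivative p t) (at t within {0..1})" if "t \<in> {0..1}" for t
    unfolding P_def by (rule integral_has_real_derivative[OF p_cont that])
  have p_nonneg: "0 \<le> p t" if "t \<in> {0..1}" for t
    using a_pos[OF that] unfolding p_def by simp
  define u where "u t = u0 + Re (sol c t)" for t
  define m where "m t = Im (sol c t)" for t
  define H where "H t = \<Gamma> (m t) + a t * F (u t)" for t
  have \<Gamma>_nonneg: "0 \<le> \<Gamma> s" for s
    using \<Gamma>_inc[of 0 s] \<Gamma>_dec[of 0 s] \<Gamma>_0 by (cases s "0::real" rule: linorder_cases) auto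
  \<comment> \<open>The contributions \<open>a * \<phi> * g\<close> cancel, leaving the explicit
    dependence of the energy on \<open>x\<close>.\<close>
  have H: "(H has_real_derivative a' t * F (u t)) (at t within {0..1})" if t: "t \<in> {0..1}" for t
  proof -
    have u: "(u has_real_derivative - g (m t)) (at t within {0..1})"
      unfolding u_def m_def using DERIV_add[OF DERIV_const[of u0] Re_sol_deriv[OF t, of c]] by simp
    have m: "(m has_real_derivative a t * \<phi> (u t)) (at t within {0..1})"
      unfolding u_def m_def using Im_sol_deriv[OF t, of c] by simp
    have "(H has_real_derivative g (m t) * (a t * \<phi> (u t)) + (a' t * F (u t) + (\<phi> (u t) * (- g (m t))) * a t))
        (at t within {0..1})"
      unfolding H_def
      by (intro DERIV_add DERIV_mult' DERIV_mult a_deriv t DERIV_chain2[OF \<Gamma> m] DERIV_chain2[OF F_deriv u])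
    then show ?thesis by (simp add: algebra_simps)
  qed
  \<comment> \<open>Since \<open>a' \<le> p * a\<close> and since \<open>F\<close> and
    \<open>\<Gamma>\<close> are nonnegative, \<open>exp (- P) * H\<close> is nonincreasing. The
    exponential factor in the hypothesis is \<open>exp (P 1)\<close>.\<close>
  define E where "E t = - (exp (- P t) * H t)" for t
  have E: "(E has_real_derivative exp (- P t) * (p t * H t - a' t * F (u t))) (at t within {0..1})"
    if "t \<in> {0..1}" for t
    unfolding E_def using P[OF that] H[OF that] by (auto intro!: derivative_eq_intros simp: algebra_simps)
  have "E 0 \<le> E t"
  proof (rule within_deriv_mono[OF E])
    fix x :: real assume "0 < x" "x < t"
    then have x: "x \<in> {0..1}" using t by auto
    have "a' x * F (u x) \<le> (p x * a x) * F (u x)"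
      using a_pos[OF x] F_nonneg unfolding p_def by (intro mult_right_mono) auto
    also have "\<dots> \<le> p x * H x"
      using p_nonneg[OF x] \<Gamma>_nonneg unfolding H_def by (simp add: algebra_simps)
    finally show "0 \<le> exp (- P x) * (p x * H x - a' x * F (u x))" by simp
  qed (use t in auto)
  then have "exp (- P t) * H t \<le> a 0 * F c"
    by (simp add: E_def P_def H_def u_def m_def \<Gamma>_0)
  then have "exp (P t) * (exp (- P t) * H t) \<le> exp (P t) * (a 0 * F c)"
    by (rule mult_left_mono) simp
  moreover have "exp (P t) * (exp (- P t) * H t) = H t" by (simp add: exp_minus)
  ultimately have "H t \<le> exp (P t) * (a 0 * F c)" by (simp only:)
  also have "\<dots> \<le> exp (P 1) * (a 0 * F c)"
  proof -
    have "P t \<le> P 1" using t p_nonneg by (intro within_deriv_mono[OF P]) auto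
    then show ?thesis using a_pos[of 0] F_nonneg[of c] by (intro mult_right_mono) auto
  qed
  also have "\<dots> \<le> 1 - sqrt (1 - d\<^sup>2)"
    using c by (simp add: P_def p_def[abs_def] mult_ac)
  finally have "H t \<le> 1 - sqrt (1 - d\<^sup>2)" .
  moreover have "\<Gamma> (m t) \<le> H t" unfolding H_def using a_pos[OF t] F_nonneg by simp
  \<comment> \<open>The bound is the common value of \<open>\<Gamma>\<close> at \<open>d\<close> and
    \<open>- d\<close>, so strict monotonicity rules out any \<open>m t\<close> beyond these two
    points.\<close>
  ultimately have le: "\<Gamma> (m t) \<le> \<Gamma> d" "\<Gamma> (m t) \<le> \<Gamma> (- d)"
    using d by (simp_all add: \<Gamma>_eq)
  have "\<bar>m t\<bar> \<le> d"
    using le \<Gamma>_inc[of d "m t"] \<Gamma>_dec[of "- d" "m t"] d by (cases "m t > d"; cases "m t < - d") auto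
  then show ?thesis by (simp add: m_def)
qed

text \<open>Such a state is a rest point of the field, and uniqueness makes the solution constant.
  Besides \<open>u0\<close>, all nonpositive values of \<open>u\<close> are rest values of the
  truncated system.\<close>

lemma sol_eq_equilibrium:
  assumes p: "p \<in> {0..1}" and t: "t \<in> {0..1}"
    and eq: "Im (sol c p) = 0" "\<phi> (u0 + Re (sol c p)) = 0"
  shows "sol c t = sol c p"
proof -
  have fp: "field s (sol c p) = 0" for s
    using eq by (simp add: field_def complex_eq_iff)
  have D: "((\<lambda>s. sol c s - sol c p) has_vector_derivative field s (sol c s) - 0) (at s within {0..1})"
    if "s \<in> {0..1}" for s
    by (intro has_vector_derivative_diff sol_deriv has_vector_derivative_const that)
  have "norm (field s (sol c s) - 0) \<le> K * norm (sol c s - sol c p)" if "s \<in> {0..1}" for s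
    using field_lipschitz[OF that, of "sol c s" "sol c p"] by (simp add: fp)
  from within_deriv_zero_iff[OF D this p t] show ?thesis by simp
qed

text \<open>
  At a nonpositive minimum the velocity vanishes and \<open>\<phi>\<close> is zero, so by uniqueness the solution
  would be constant.
\<close>
lemma sol_positive:
  assumes c: "0 < c" and end1: "Im (sol c 1) = 0" and t: "t \<in> {0..1}"
  shows "0 < u0 + Re (sol c t)"
proof (rule ccontr)
  assume neg: "\<not> 0 < u0 + Re (sol c t)"
  define u where "u t = u0 + Re (sol c t)" for t
  have u: "(u has_real_derivative - g (Im (sol c t))) (at t within {0..1})" if "t \<in> {0..1}" for t
    unfolding u_def using DERIV_add[OF DERIV_const[of u0] Re_sol_deriv[OF that, of c]] by simp
  have "continuous_on {0..1} u" by (rule DERIV_continuous_on[OF u])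
  then obtain p where p: "p \<in> {0..1}" "\<And>s. s \<in> {0..1} \<Longrightarrow> u p \<le> u s"
    using continuous_attains_inf[of "{0..1::real}" u] by auto
  have up: "u p \<le> 0" using p(2)[OF t] neg by (simp add: u_def)
  have u_0: "u 0 = c" by (simp add: u_def)
  have "p \<noteq> 0" using up u_0 c by auto
  \<comment> \<open>At an interior minimum the derivative of \<open>u\<close> vanishes, and
    \<open>g\<close> is zero only at \<open>0\<close>; at the right endpoint the end condition says
    the same.\<close>
  have Im_p: "Im (sol c p) = 0"
  proof (cases "p = 1")
    case False
    with \<open>p \<noteq> 0\<close> p have p01: "0 < p" "p < 1" by auto
    then have "(u has_real_derivative - g (Im (sol c p))) (at p)"
      using u[OF p(1)] at_within_Icc_at[of 0 p 1] by simp
    moreover have "\<forall>s. \<bar>p - s\<bar> < min p (1 - p) \<longrightarrow> u p \<le> u s"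
      using p(2) by (auto simp: abs_less_iff)
    ultimately have "- g (Im (sol c p)) = 0"
      using p01 by (intro DERIV_local_min[of u _ p "min p (1 - p)"]) auto
    then show ?thesis by simp
  qed (use end1 in simp)
  have "sol c 0 = sol c p"
    by (rule sol_eq_equilibrium[OF p(1) _ Im_p]) (use up in \<open>simp_all add: \<phi>_nonpos u_def\<close>)
  then have "c = u p" using u_0 by (simp add: u_def complex_eq_iff)
  then show False using up c by simp
qed

section \<open>Growth of the angle and choice of the initial value\<close>

lemma angle_strict_mono:
  assumes c: "c \<noteq> u0" and pos: "\<And>t. t \<in> {0..1} \<Longrightarrow> 0 < u0 + Re (sol c t)"
  shows "strict_mono_on {0..1} (angle c)"
proof (rule strict_mono_onI)
  fix s t :: real assume st: "s \<in> {0..1}" "t \<in> {0..1}" "s < t"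
  show "angle c s < angle c t"
  proof (rule within_deriv_strict_mono[OF angle_deriv[OF c]])
    fix x :: real assume "s < x" "x < t"
    then have x: "x \<in> {0..1}" using st by auto
    let ?y = "Re (sol c x)" and ?m = "Im (sol c x)"
    interpret nonvanishing_path "sol c" "\<lambda>t. field t (sol c t)" by (rule sol_nonvanishing[OF c])
    have nz: "sol c x \<noteq> 0" by (rule z_nz[OF x])
    have ge: "0 \<le> a x * (\<phi> (u0 + ?y) * ?y)" "0 \<le> g ?m * ?m"
      using \<phi>_sign[of "u0 + ?y"] a_pos[OF x] g_sign' by simp_all
    \<comment> \<open>Where \<open>?m\<close> vanishes, \<open>?y\<close> cannot, since the path
      avoids the origin; the \<open>\<phi>\<close> term is then positive because \<open>u\<close>
      is. Elsewhere the \<open>g\<close> term is positive.\<close>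
    have "0 < a x * (\<phi> (u0 + ?y) * ?y) + g ?m * ?m"
    proof (cases "?m = 0")
      case True
      then have "?y \<noteq> 0" using nz by (simp add: complex_eq_iff)
      then have "0 < \<phi> (u0 + ?y) * ?y" using \<phi>_sign_strict[OF pos[OF x]] by simp
      then have "0 < a x * (\<phi> (u0 + ?y) * ?y)" by (rule mult_pos_pos[OF a_pos[OF x]])
      then show ?thesis using ge(2) by (rule add_pos_nonneg)
    qed (use ge g_sign in \<open>auto intro: add_nonneg_pos\<close>)
    then show "0 < (a x * (\<phi> (u0 + ?y) * ?y) + g ?m * ?m) / (norm (sol c x))\<^sup>2"
      using nz by simp
  qed (use st in auto)
qed

text \<open>To reach \<open>pi\<close> the angle would have to pass \<open>pi / 2\<close>, where the
  real part vanishes.\<close>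

lemma angle_lt_pi:
  assumes c: "c \<noteq> u0" and ne: "\<And>t. t \<in> {0..1} \<Longrightarrow> Re (sol c t) \<noteq> 0"
  shows "angle c 1 < pi"
proof (rule ccontr)
  assume "\<not> angle c 1 < pi"
  then have "angle c 0 \<le> pi / 2" "pi / 2 \<le> angle c 1" using pi_gt_zero by (simp, linarith)
  from IVT'[OF this _ angle_cont[OF c]] obtain t where t: "t \<in> {0..1}" "angle c t = pi / 2" by auto
  from sol_polar[OF c t(1)] show False using ne[OF t(1)] t(2) by (metis cos_pi_half mult_zero_right)
qed

text \<open>A start close to \<open>u0\<close> keeps the solution in the
  \<open>\<epsilon>\<close>-neighbourhood, where chords of \<open>\<phi>\<close> from
  \<open>u0\<close> have slope at least \<open>\<mu>\<close>. With \<open>g_ge\<close> the angle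
  turns at least as fast as for the linear problem with parameter \<open>\<mu> > l\<close>.\<close>

lemma angle_gt_prufer:
  assumes c: "c \<noteq> u0" and small: "\<bar>c - u0\<bar> * exp K < \<epsilon>"
    and bound: "\<And>t. t \<in> {0..1} \<Longrightarrow> \<bar>Im (sol c t)\<bar> \<le> d"
    and \<mu>: "\<And>s. \<bar>s - u0\<bar> < \<epsilon> \<Longrightarrow> \<mu> * (s - u0)\<^sup>2 \<le> \<phi> s * (s - u0)"
    and \<theta>: "prufer_solution a l \<theta>" and l: "l < \<mu>"
  shows "\<theta> 1 < angle c 1"
proof -
  interpret nonvanishing_path "sol c" "\<lambda>t. field t (sol c t)" by (rule sol_nonvanishing[OF c])
  obtain b where b: "\<And>t. t \<in> {0..1} \<Longrightarrow> a t \<le> b"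
    using continuous_attains_sup[OF compact_Icc _ a_cont]
    by (metis atLeastAtMost_iff empty_iff order_refl zero_le_one)
  show ?thesis
  proof (rule prufer_comparison[OF angle_deriv[OF c]])
    fix t :: real assume t: "t \<in> {0..1}"
    let ?y = "Re (sol c t)" and ?m = "Im (sol c t)"
    have "\<bar>?y\<bar> < \<epsilon>"
      using abs_Re_le_cmod[of "sol c t"] sol_norm_le[OF t, of c] small by linarith
    then have "\<mu> * ?y\<^sup>2 \<le> \<phi> (u0 + ?y) * ?y" using \<mu>[of "u0 + ?y"] by simp
    then have "a t * (\<mu> * ?y\<^sup>2) \<le> a t * (\<phi> (u0 + ?y) * ?y)"
      using a_pos[OF t] by (intro mult_left_mono) auto
    then have "?m\<^sup>2 + \<mu> * a t * ?y\<^sup>2 \<le> a t * (\<phi> (u0 + ?y) * ?y) + g ?m * ?m"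
      using g_ge[OF bound[OF t]] by (simp add: mult_ac)
    then have "(?m\<^sup>2 + \<mu> * a t * ?y\<^sup>2) / (norm (sol c t))\<^sup>2
        \<le> (a t * (\<phi> (u0 + ?y) * ?y) + g ?m * ?m) / (norm (sol c t))\<^sup>2"
      by (rule divide_right_mono) simp
    then show "(sin (angle c t))\<^sup>2 + \<mu> * a t * (cos (angle c t))\<^sup>2
        \<le> (a t * (\<phi> (u0 + ?y) * ?y) + g ?m * ?m) / (norm (sol c t))\<^sup>2"
      by (simp add: angle_squares[OF c t] add_divide_distrib)
    show "(\<theta> has_real_derivative (sin (\<theta> t))\<^sup>2 + l * a t * (cos (\<theta> t))\<^sup>2) (at t within {0..1})"
      using \<theta> t by (simp add: prufer_solution_def)
  qed (use a_pos b l \<theta> in \<open>auto simp: prufer_solution_def\<close>)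
qed

text \<open>The initial value runs along the segment from \<open>u0\<close> to \<open>c0\<close>:
  near \<open>u0\<close> the final angle exceeds \<open>k * pi\<close>, at \<open>c0\<close> it is
  below \<open>pi\<close>. The energy condition at \<open>c0\<close> passes to the whole segment by
  the monotonicity of \<open>F\<close> on each side of \<open>u0\<close>.\<close>

lemma ex_shooting_value:
  assumes c0: "0 \<le> c0" "c0 \<noteq> u0"
    and energy: "a 0 * exp (integral {0..1} (\<lambda>t. max (a' t) 0 / a t)) * F c0 \<le> 1 - sqrt (1 - d\<^sup>2)"
    and ne: "\<And>t. t \<in> {0..1} \<Longrightarrow> Re (sol c0 t) \<noteq> 0"
    and \<mu>: "\<And>s. \<bar>s - u0\<bar> < \<epsilon> \<Longrightarrow> \<mu> * (s - u0)\<^sup>2 \<le> \<phi> s * (s - u0)" and \<epsilon>: "0 < \<epsilon>"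
    and \<theta>: "prufer_solution a l \<theta>" "k * pi \<le> \<theta> 1" and l: "l < \<mu>"
    and j: "1 \<le> j" "j \<le> k"
  shows "\<exists>c>0. c \<noteq> u0 \<and> 0 < (c - u0) * (c0 - u0) \<and> \<bar>c - u0\<bar> \<le> \<bar>c0 - u0\<bar> \<and>
    (\<forall>t\<in>{0..1}. \<bar>Im (sol c t)\<bar> \<le> d) \<and> angle c 1 = real j * pi"
proof -
  define C where "C s = u0 + s * (c0 - u0)" for s
  have C: "C s \<noteq> u0" if "s \<noteq> 0" for s using that c0 by (simp add: C_def)
  have bound: "\<bar>Im (sol (C s) t)\<bar> \<le> d" if s: "0 < s" "s \<le> 1" and t: "t \<in> {0..1}" for s t
  proof (rule energy_bound[OF _ t])
    have "F (C s) \<le> F c0"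
    proof (cases "c0 < u0")
      case True
      have "0 \<le> (1 - s) * (u0 - c0)" "0 \<le> s * (u0 - c0)" using True s by auto
      then have "c0 \<le> C s" "C s \<le> u0" by (auto simp: C_def algebra_simps)
      then show ?thesis by (rule F_antimono)
    next
      case False
      then have "0 \<le> (1 - s) * (c0 - u0)" "0 \<le> s * (c0 - u0)" using s by auto
      then have "u0 \<le> C s" "C s \<le> c0" by (auto simp: C_def algebra_simps)
      then show ?thesis by (rule F_mono)
    qed
    then have "a 0 * exp (integral {0..1} (\<lambda>t. max (a' t) 0 / a t)) * F (C s)
        \<le> a 0 * exp (integral {0..1} (\<lambda>t. max (a' t) 0 / a t)) * F c0"
      using a_pos[of 0] by (intro mult_left_mono) auto
    with energy show "a 0 * exp (integral {0..1} (\<lambda>t. max (a' t) 0 / a t)) * F (C s) \<le> 1 - sqrt (1 - d\<^sup>2)"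
      by linarith
  qed
  \<comment> \<open>Gronwall enlarges the initial distance by at most the factor
    \<open>exp K\<close>; the factor \<open>2\<close> leaves the result strictly below
    \<open>\<epsilon>\<close>.\<close>
  define s1 where "s1 = min 1 (\<epsilon> / (2 * (\<bar>c0 - u0\<bar> * exp K)))"
  have B: "0 < \<bar>c0 - u0\<bar> * exp K" using c0 by simp
  have s1: "0 < s1" "s1 \<le> 1" using B \<epsilon> by (auto simp: s1_def)
  have "s1 * (\<bar>c0 - u0\<bar> * exp K) \<le> \<epsilon> / (2 * (\<bar>c0 - u0\<bar> * exp K)) * (\<bar>c0 - u0\<bar> * exp K)"
    using B by (intro mult_right_mono) (auto simp: s1_def)
  also have "\<dots> = \<epsilon> / 2" using c0 by simp
  finally have "s1 * (\<bar>c0 - u0\<bar> * exp K) < \<epsilon>" using \<epsilon> by simp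
  then have "\<bar>C s1 - u0\<bar> * exp K < \<epsilon>" using s1 by (simp add: C_def abs_mult mult_ac)
  then have "\<theta> 1 < angle (C s1) 1"
    using C s1 bound by (intro angle_gt_prufer[OF _ _ _ \<mu> \<theta>(1) l]) auto
  moreover have "j * pi \<le> k * pi" using j by simp
  ultimately have hi: "j * pi \<le> angle (C s1) 1" using \<theta>(2) by linarith
  have "C 1 = c0" by (simp add: C_def)
  then have lt: "angle (C 1) 1 < pi" using angle_lt_pi[OF c0(2) ne] by simp
  have "pi \<le> j * pi" using j by simp
  then have lo: "angle (C 1) 1 \<le> j * pi" using lt by linarith
  have "continuous_on {s1..1} (\<lambda>s. angle (C s) 1)"
  proof (rule continuous_on_compose2[OF angle_cont_initial])
    show "continuous_on {s1..1} C" unfolding C_def by (intro continuous_intros)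
    have "C s \<noteq> u0" if "s \<in> {s1..1}" for s using that s1 by (intro C) auto
    then show "C ` {s1..1} \<subseteq> - {u0}" by blast
  qed
  from IVT2'[OF lo hi s1(2) this] obtain s where s: "s1 \<le> s" "s \<le> 1" "angle (C s) 1 = j * pi" by auto
  \<comment> \<open>Excluding the far end matters for \<open>c0 = 0\<close>, where only
    \<open>s < 1\<close> gives a positive initial value.\<close>
  have "s \<noteq> 1" using s(3) lt \<open>pi \<le> j * pi\<close> by auto
  then have s01: "0 < s" "s < 1" using s s1 by auto
  have "C s = (1 - s) * u0 + s * c0" by (simp add: C_def algebra_simps)
  then have "0 < C s" using s01 u0 c0 by (simp add: add_pos_nonneg)
  moreover have "0 < (C s - u0) * (c0 - u0)"
    using s01 c0 by (simp add: C_def mult.assoc flip: power2_eq_square)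
  moreover have "\<bar>C s - u0\<bar> \<le> \<bar>c0 - u0\<bar>"
    using s01 mult_right_mono[of s 1 "\<bar>c0 - u0\<bar>"] by (simp add: C_def abs_mult)
  ultimately show ?thesis using C[of s] s01 bound[of s] s(3) by (intro exI[of _ "C s"]) auto
qed

section \<open>From shooting values to solutions of the original problem\<close>

lemma Re_sol_near:
  assumes t: "t \<in> {0..1}"
  shows "\<bar>u0 + Re (sol c t) - c\<bar> \<le> slope_of d"
proof -
  have "norm (Re (sol c t) - Re (sol c 0)) \<le> slope_of d * norm (t - 0)"
    using g_bound t
    by (intro field_differentiable_bound[OF convex_real_interval(5) Re_sol_deriv]) auto
  also have "\<dots> \<le> slope_of d * 1" using t d sqrt_d by (intro mult_left_mono) auto
  finally show ?thesis by (simp add: algebra_simps)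
qed

text \<open>Along this solution \<open>\<phi>\<close> agrees with \<open>f\<close> and
  \<open>g\<close> with \<open>slope_of\<close>, so the truncated system is the original one.
  Agreement with \<open>f\<close> is asked for at positive values only, because positivity is
  derived inside from the end condition.\<close>

lemma sol_solves:
  assumes c: "0 < c" "c \<noteq> u0" and bound: "\<And>t. t \<in> {0..1} \<Longrightarrow> \<bar>Im (sol c t)\<bar> \<le> d"
    and angle: "angle c 1 = real j * pi" and j: "1 \<le> j"
    and f: "\<And>t. t \<in> {0..1} \<Longrightarrow> 0 < u0 + Re (sol c t) \<Longrightarrow> \<phi> (u0 + Re (sol c t)) = f (u0 + Re (sol c t))"
    and rel: "\<And>s. rel s 0 \<longleftrightarrow> s * (c - u0) < 0"
  shows "C2_solution a f (\<lambda>t. u0 + Re (sol c t)) \<and>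
    exactly_nodal_points rel u0 (\<lambda>t. u0 + Re (sol c t)) j"
proof -
  define u where "u t = u0 + Re (sol c t)" for t
  define w where "w t = - Im (sol c t)" for t
  have w_le: "\<bar>w t\<bar> \<le> d" if "t \<in> {0..1}" for t using bound[OF that] by (simp add: w_def)
  have one: "(1::real) \<in> {0..1}" and zero: "(0::real) \<in> {0..1}" by simp_all
  have w01: "w 0 = 0" "w 1 = 0"
  proof -
    \<comment> \<open>An angle \<open>j * pi\<close> puts the final state on the real axis, which is
      the Neumann condition at \<open>1\<close>.\<close>
    have "sin (angle c 1) = 0" using angle by simp
    then show "w 1 = 0" using sol_polar[OF c(2) one] unfolding w_def by (metis mult_zero_right neg_0_equal_iff_equal)
  qed (simp add: w_def)
  have pos: "0 < u t" if "t \<in> {0..1}" for t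
    using sol_positive[OF c(1) _ that] w01 by (simp add: w_def u_def)
  have u: "(u has_real_derivative slope_of (w t)) (at t within {0..1})" if t: "t \<in> {0..1}" for t
  proof -
    have "- g (Im (sol c t)) = slope_of (w t)" using g_eq[OF bound[OF t]] by (simp add: w_def)
    then show ?thesis
      unfolding u_def using DERIV_add[OF DERIV_const[of u0] Re_sol_deriv[OF t, of c]] by simp
  qed
  have w: "(w has_real_derivative - (a t * f (u t))) (at t within {0..1})" if t: "t \<in> {0..1}" for t
    using DERIV_minus[OF Im_sol_deriv[OF t, of c]] f[OF t] pos[OF t] by (simp add: w_def[abs_def] u_def)
  define u2 where "u2 t = 1 / ((1 - (w t)\<^sup>2) * sqrt (1 - (w t)\<^sup>2)) * (- (a t * f (u t)))" for t
  have u1: "((\<lambda>t. slope_of (w t)) has_real_derivative u2 t) (at t within {0..1})" if t: "t \<in> {0..1}" for t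
    unfolding u2_def using w_le[OF t] d by (intro DERIV_chain2[OF slope_of_deriv w[OF t]]) auto
  have cu: "continuous_on {0..1} u" by (rule DERIV_continuous_on[OF u])
  have cw: "continuous_on {0..1} w" by (rule DERIV_continuous_on[OF w])
  have w2: "(w t)\<^sup>2 < 1" if "t \<in> {0..1}" for t
    using w_le[OF that] d by (simp add: abs_square_less_1)
  have "continuous_on {0..1} (\<lambda>t. f (u t)) \<longleftrightarrow> continuous_on {0..1} (\<lambda>t. \<phi> (u t))"
    by (rule continuous_on_cong[OF refl]) (use f pos in \<open>auto simp: u_def\<close>)
  then have cf: "continuous_on {0..1} (\<lambda>t. f (u t))"
    using continuous_on_compose2[OF \<phi>_cont[of UNIV] cu] by simp
  have nz: "(1 - (w t)\<^sup>2) * sqrt (1 - (w t)\<^sup>2) \<noteq> 0" if "t \<in> {0..1}" for t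
    using w2[OF that] by simp
  have u2: "continuous_on {0..1} u2"
    unfolding u2_def
    by (intro continuous_on_mult continuous_on_divide continuous_on_minus continuous_on_diff continuous_on_power
        continuous_on_real_sqrt continuous_on_const cw cf a_cont ballI nz)
  have lim: "t islimpt {0..1}" if "t \<in> {0..1}" for t :: real
    using islimpt_interval_real[of "{0..1}" 0 1 t] that by simp
  have du: "deriv_on {0..1} u t = slope_of (w t)" if "t \<in> {0..1}" for t
    by (rule deriv_on_eqI[OF u[OF that] lim[OF that]])
  have curv: "deriv_on {0..1} u t / sqrt (1 + (deriv_on {0..1} u t)\<^sup>2) = w t" if t: "t \<in> {0..1}" for t
  proof -
    have q: "0 < 1 - (w t)\<^sup>2" using w2[OF t] by simp
    then have "1 + (slope_of (w t))\<^sup>2 = 1 / (1 - (w t)\<^sup>2)"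
      by (simp add: power_divide field_simps)
    then show ?thesis using q unfolding du[OF t] by (simp add: real_sqrt_divide)
  qed
  have "deriv_on {0..1} (\<lambda>t. deriv_on {0..1} u t / sqrt (1 + (deriv_on {0..1} u t)\<^sup>2)) t = - (a t * f (u t))"
    if t: "t \<in> {0..1}" for t
    by (rule deriv_on_eqI[OF has_real_derivative_transform[OF t curv w[OF t]] lim[OF t]])
  then have sol: "C2_solution a f u"
    unfolding C2_solution_def
    using Ck_on_2I[OF u u1 u2 lim] pos du[OF zero] du[OF one] w01 by auto
  have "\<exists>x. nodal_points rel u0 u j x"
  proof (rule rotating_nodal_points[of u "\<lambda>t. slope_of (w t)" u2 "angle c" j u0 "c - u0" rel])
    show "strict_mono_on {0..1} (angle c)"
      by (rule angle_strict_mono[OF c(2)]) (use pos in \<open>simp add: u_def\<close>)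
    fix t :: real assume "t \<in> {0..1}"
    from sol_polar[OF c(2) this] show "\<exists>r>0. u t - u0 = (c - u0) * r * cos (angle c t)"
      by (metis add_diff_cancel_left' u_def)
  qed (use u u1 u2 angle_cont angle j rel w01 c in simp_all)
  moreover have "\<not> rel 0 0" using rel[of 0] by simp
  ultimately have "exactly_nodal_points rel u0 u j" by (simp add: exactly_nodal_points_iff)
  with sol show ?thesis unfolding u_def[abs_def] by blast
qed

end

section \<open>The two families of solutions\<close>

text \<open>The threshold \<open>1\<close> is the value of \<open>1 - sqrt (1 - d\<^sup>2)\<close>
  at \<open>d = 1\<close>, where the slope becomes infinite. The witness solves
  \<open>1 - sqrt (1 - d\<^sup>2) = e\<close>, and \<open>e \<ge> 1 / 2\<close> keeps it
  positive.\<close>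

lemma ex_velocity_bound:
  fixes h :: real
  assumes "h < 1"
  shows "\<exists>d. 0 < d \<and> d < 1 \<and> h \<le> 1 - sqrt (1 - d\<^sup>2)"
proof -
  define e where "e = max h (1 / 2)"
  have e: "1 / 2 \<le> e" "e < 1" "h \<le> e" using assms by (auto simp: e_def)
  have sq: "0 < (1 - e)\<^sup>2" "(1 - e)\<^sup>2 < 1" using e by (simp_all add: abs_square_less_1)
  show ?thesis
    using e sq by (intro exI[of _ "sqrt (1 - (1 - e)\<^sup>2)"]) auto
qed

lemma ex_slope_neighbourhood:
  fixes f :: "real \<Rightarrow> real"
  assumes f: "(f has_real_derivative D) (at p)" and D: "\<mu> < D" and fp: "f p = 0"
  shows "\<exists>\<epsilon>>0. \<forall>s. \<bar>s - p\<bar> < \<epsilon> \<longrightarrow> \<mu> * (s - p)\<^sup>2 \<le> f s * (s - p)"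
proof -
  have "((\<lambda>s. (f s - f p) / (s - p)) \<longlongrightarrow> D) (at p)"
    using f by (simp add: has_field_derivative_iff)
  from order_tendstoD(1)[OF this D] obtain \<epsilon> where \<epsilon>: "0 < \<epsilon>"
    "\<And>s. s \<noteq> p \<Longrightarrow> \<bar>s - p\<bar> < \<epsilon> \<Longrightarrow> \<mu> < (f s - f p) / (s - p)"
    by (auto simp: eventually_at dist_real_def)
  have "\<mu> * (s - p)\<^sup>2 \<le> f s * (s - p)" if s: "\<bar>s - p\<bar> < \<epsilon>" for s
  proof (cases "s = p")
    case False
    then have "\<mu> * (s - p)\<^sup>2 \<le> (f s - f p) / (s - p) * (s - p)\<^sup>2"
      using \<epsilon>(2)[OF _ s] by (intro mult_right_mono) auto
    then show ?thesis using False fp by (simp add: power2_eq_square)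
  qed simp
  with \<epsilon>(1) show ?thesis by blast
qed

text \<open>One argument serves both families. Below \<open>u0\<close> the far end of the shooting
  segment is \<open>0\<close>; above, it is a value from which the solution cannot come back to
  \<open>u0\<close>.\<close>

lemma branch_of_solutions:
  fixes k :: nat and a f :: "real \<Rightarrow> real" and u0 lam d c0 :: real
  assumes a_C1: "Ck_on 1 {0..1} a" and a_pos: "\<forall>x\<in>{0..1}. a x > 0"
    and u0: "u0 > 0" and f_C1: "Ck_on 1 {0..} f" and f_0: "f 0 = 0" and f_u0: "f u0 = 0"
    and f_neg: "\<forall>s\<in>{0<..<u0}. f s < 0" and f_pos: "\<forall>s\<in>{u0<..}. f s > 0"
    and ev: "nth_neumann_eigenvalue a (k + 1) lam" and lam: "deriv_on {0..} f u0 > lam"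
    and d: "0 < d" "d < 1" and c0: "c0 = 0 \<or> c0 = u0 + slope_of d + 1"
    and energy: "a 0 * exp (LBINT x=0..1. max (deriv_on {0..1} a x) 0 / a x) * (LBINT s=u0..c0. f s)
      \<le> 1 - sqrt (1 - d\<^sup>2)"
    and rel: "\<And>s. rel s 0 \<longleftrightarrow> s * (c0 - u0) < 0"
    and j: "j \<in> {1..k}"
  shows "\<exists>u. C2_solution a f u \<and> exactly_nodal_points rel u0 u j"
proof -
  have slope: "0 < slope_of d" using d by (simp add: abs_square_less_1)
  \<comment> \<open>Room for the largest initial value \<open>u0 + slope_of d + 1\<close> and a
    displacement of at most \<open>slope_of d\<close>.\<close>
  define R where "R = u0 + 2 * slope_of d + 2"
  have R: "u0 < R" "0 < R" using slope u0 by (auto simp: R_def)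
  have c0R: "c0 \<in> {0..R}" using c0 slope u0 by (auto simp: R_def)
  \<comment> \<open>Clamping continues \<open>f\<close> by \<open>f 0 = 0\<close> to the left and by
    the positive constant \<open>f R\<close> to the right, which preserves the sign pattern.\<close>
  define \<phi> where "\<phi> s = f (clamp_to 0 R s)" for s
  have \<phi>_eq: "\<phi> s = f s" if "s \<in> {0..R}" for s
    using clamp_to_id[OF that] by (simp add: \<phi>_def)
  have f': "(f has_real_derivative deriv_on {0..} f s) (at s within {0..R})" if "s \<in> {0..R}" for s
    using Ck_on_1D(1)[OF f_C1, of s] that has_field_derivative_subset[of f _ s "{0..}" "{0..R}"] by auto
  have cont_f': "continuous_on {0..R} (deriv_on {0..} f)"
    by (rule continuous_on_subset[OF Ck_on_1D(2)[OF f_C1]]) auto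
  from clamp_comp_lipschitz[OF f' cont_f'] R obtain Lp
    where Lp: "\<And>s t. \<bar>\<phi> s - \<phi> t\<bar> \<le> Lp * \<bar>s - t\<bar>" unfolding \<phi>_def by auto
  have "Lp \<ge> 0" using Lp[of 1 0] abs_ge_zero[of "\<phi> 1 - \<phi> 0"] by simp
  then have "Lp-lipschitz_on UNIV \<phi>" by (intro lipschitz_onI) (auto simp: dist_real_def Lp)
  then have "continuous_on UNIV \<phi>" by (rule lipschitz_on_continuous_on)
  from continuous_antiderivative_real[OF this] obtain F
    where F: "F u0 = 0" "\<And>s. (F has_real_derivative \<phi> s) (at s)" by blast
  interpret shooting a "deriv_on {0..1} a" \<phi> F u0 d Lp
  proof unfold_locales
    show "\<phi> s = 0" if "s \<le> 0" for s
      using that R f_0 by (simp add: \<phi>_def clamp_to_def)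
    show "\<phi> s < 0" if "0 < s" "s < u0" for s
      using that R f_neg \<phi>_eq[of s] by auto
    show "0 < \<phi> s" if "u0 < s" for s
      using that R u0 f_pos by (auto simp: \<phi>_def clamp_to_def max_def min_def)
    show "\<phi> u0 = 0" using \<phi>_eq[of u0] R u0 f_u0 by simp
  qed (use Ck_on_1D[OF a_C1] a_pos Lp F u0 d in auto)
  have P: "(LBINT x=0..1. max (deriv_on {0..1} a x) 0 / a x)
      = integral {0..1} (\<lambda>t. max (deriv_on {0..1} a t) 0 / a t)"
  proof -
    have "continuous_on {0..1} (\<lambda>t. max (deriv_on {0..1} a t) 0 / a t)"
      by (intro continuous_intros a'_cont a_cont) (use a_pos in force)
    from interval_integral_eq_integral[OF _ borel_integrable_atLeastAtMost'[OF this]]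
    show ?thesis by (simp add: zero_ereal_def one_ereal_def)
  qed
  have F_c0: "(LBINT s=u0..c0. f s) = F c0"
  proof -
    have sub: "{min u0 c0..max u0 c0} \<subseteq> {0..R}" using c0R R u0 by auto
    have "(LBINT s=u0..c0. f s) = F c0 - F u0"
    proof (rule interval_integral_FTC_finite)
      show "continuous_on {min u0 c0..max u0 c0} f"
        by (rule continuous_on_subset[OF DERIV_continuous_on[OF f'] sub])
      fix s assume s: "min u0 c0 \<le> s" "s \<le> max u0 c0"
      then have "s \<in> {0..R}" using sub by (metis atLeastAtMost_iff subsetD)
      then have "(F has_real_derivative f s) (at s within {min u0 c0..max u0 c0})"
        using F(2)[of s] by (simp add: \<phi>_eq has_field_derivative_at_within)
      then show "(F has_vector_derivative f s) (at s within {min u0 c0..max u0 c0})"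
        by (simp add: has_real_derivative_iff_has_vector_derivative)
    qed
    then show ?thesis by (simp add: F)
  qed
  have c0_ne: "c0 \<noteq> u0" using c0 u0 slope by auto
  \<comment> \<open>The start \<open>0\<close> is a rest point. The other start exceeds
    \<open>u0\<close> by more than \<open>slope_of d\<close>, and that is the largest displacement
    over the unit interval because \<open>g\<close> is bounded by it.\<close>
  have ne: "Re (sol c0 t) \<noteq> 0" if t: "t \<in> {0..1}" for t
    using c0
  proof
    assume "c0 = 0"
    then have "sol c0 t = sol c0 0"
      using \<phi>_nonpos[of 0] by (intro sol_eq_equilibrium t) auto
    then show ?thesis using c0_ne by simp
  qed (use Re_sol_near[OF t, of c0] in auto)
  define \<mu> where "\<mu> = (lam + deriv_on {0..} f u0) / 2"
  have \<mu>: "lam < \<mu>" "\<mu> < deriv_on {0..} f u0" using lam by (auto simp: \<mu>_def field_simps)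
  have "(f has_real_derivative deriv_on {0..} f u0) (at u0)"
    using f'[of u0] at_within_Icc_at[of 0 u0 R] u0 R by simp
  from ex_slope_neighbourhood[OF this \<mu>(2) f_u0] obtain \<epsilon>0 where \<epsilon>0: "0 < \<epsilon>0"
    "\<And>s. \<bar>s - u0\<bar> < \<epsilon>0 \<Longrightarrow> \<mu> * (s - u0)\<^sup>2 \<le> f s * (s - u0)" by blast
  define \<epsilon> where "\<epsilon> = min \<epsilon>0 (min u0 (R - u0))"
  have \<epsilon>: "0 < \<epsilon>" using \<epsilon>0 u0 R by (simp add: \<epsilon>_def)
  have near: "\<mu> * (s - u0)\<^sup>2 \<le> \<phi> s * (s - u0)" if "\<bar>s - u0\<bar> < \<epsilon>" for s
  proof -
    have "s \<in> {0..R}" using that by (auto simp: \<epsilon>_def)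
    then show ?thesis using \<epsilon>0(2)[of s] that by (simp add: \<phi>_eq \<epsilon>_def)
  qed
  obtain \<theta> where \<theta>: "prufer_solution a lam \<theta>" "k * pi \<le> \<theta> 1"
    using nth_neumann_eigenvalue_prufer[OF ev a_cont] a_pos by blast
  have "0 \<le> c0" using c0R by simp
  from ex_shooting_value[OF this c0_ne energy[unfolded P F_c0] ne near \<epsilon> \<theta> \<mu>(1), of j] j
  obtain c where c: "0 < c" "c \<noteq> u0" "0 < (c - u0) * (c0 - u0)" "\<bar>c - u0\<bar> \<le> \<bar>c0 - u0\<bar>"
    "\<And>t. t \<in> {0..1} \<Longrightarrow> \<bar>Im (sol c t)\<bar> \<le> d" "angle c 1 = real j * pi" by auto
  have "c \<le> u0 + slope_of d + 1"
    using c0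
  proof
    assume "c0 = 0"
    then have "c < u0" using c(3) u0 by (simp add: mult_less_0_iff)
    then show ?thesis using slope by simp
  qed (use c(4) slope in auto)
  then have "u0 + Re (sol c t) \<le> R" if "t \<in> {0..1}" for t
    using Re_sol_near[OF that, of c] by (simp add: R_def)
  then have f_eq: "\<phi> (u0 + Re (sol c t)) = f (u0 + Re (sol c t))"
    if "t \<in> {0..1}" "0 < u0 + Re (sol c t)" for t
    using that by (intro \<phi>_eq) auto
  have "rel s 0 \<longleftrightarrow> s * (c - u0) < 0" for s
    using c(3) by (auto simp: rel mult_less_0_iff zero_less_mult_iff)
  with sol_solves[OF c(1,2,5,6) _ f_eq] j show ?thesis by auto
qed

text \<open>Cutting off the half-line lowers the integral of a nonnegative function. This carries
  the smallness condition on the improper integral over to a finite starting value.\<close>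

lemma interval_integral_le_at_top:
  fixes f :: "real \<Rightarrow> real"
  assumes int: "interval_lebesgue_integrable lborel (ereal p) \<infinity> f"
    and nonneg: "\<And>s. p < s \<Longrightarrow> 0 \<le> f s" and pq: "p \<le> q"
  shows "(LBINT s=p..q. f s) \<le> (LBINT s=p..\<infinity>. f s)"
proof -
  have "integrable lborel (\<lambda>s. indicator (einterval (ereal p) \<infinity>) s *\<^sub>R f s)"
    using int by (simp add: interval_lebesgue_integrable_def set_integrable_def)
  then have "(\<integral>s. indicator (einterval (ereal p) (ereal q)) s *\<^sub>R f s \<partial>lborel)
      \<le> (\<integral>s. indicator (einterval (ereal p) \<infinity>) s *\<^sub>R f s \<partial>lborel)"
    using nonneg by (intro integral_mono_AE') (auto simp: indicator_def einterval_def)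
  then show ?thesis
    using pq by (simp add: interval_lebesgue_integral_le_eq set_lebesgue_integral_def)
qed

text \<open>Since \<open>f\<close> is positive beyond \<open>u0\<close>, the integrability condition
  says that the improper integral is finite; a divergent one would take the default value
  \<open>0\<close> and satisfy the inequality spuriously.\<close>

theorem theorem6p1:
  fixes k :: nat and a f :: "real \<Rightarrow> real" and u0 lam :: real
  assumes "k \<ge> 1"
    and "Ck_on 1 {0..1} a" and "\<forall>x\<in>{0..1}. a x > 0"
    and "u0 > 0"
    and "Ck_on 1 {0..} f" and "f 0 = 0" and "f u0 = 0"
    and "\<forall>s\<in>{0<..<u0}. f s < 0" and "\<forall>s\<in>{u0<..}. f s > 0"
    and "nth_neumann_eigenvalue a (k + 1) lam" and "deriv_on {0..} f u0 > lam"
  shows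
    "(a 0 * exp (LBINT x=0..1. max (deriv_on {0..1} a x) 0 / a x) * (LBINT s=u0..0. f s) < 1 \<longrightarrow>
        (\<exists>u :: nat \<Rightarrow> real \<Rightarrow> real.
           (\<forall>j\<in>{1..k}. C2_solution a f (u j) \<and> \<not> u j constant_on {0..1} \<and>
              exactly_nodal_points (>) u0 (u j) j) \<and>
           (\<forall>i\<in>{1..k}. \<forall>j\<in>{1..k}. i \<noteq> j \<longrightarrow> (\<exists>t\<in>{0..1}. u i t \<noteq> u j t)))) \<and>
     (interval_lebesgue_integrable lborel (ereal u0) \<infinity> f \<and>
      a 0 * exp (LBINT x=0..1. max (deriv_on {0..1} a x) 0 / a x) * (LBINT s=u0..\<infinity>. f s) < 1 \<longrightarrow>
        (\<exists>u :: nat \<Rightarrow> real \<Rightarrow> real.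
           (\<forall>l\<in>{1..k}. C2_solution a f (u (2 * k + 1 - l)) \<and>
              \<not> u (2 * k + 1 - l) constant_on {0..1} \<and>
              exactly_nodal_points (<) u0 (u (2 * k + 1 - l)) l) \<and>
           (\<forall>i\<in>{k + 1..2 * k}. \<forall>j\<in>{k + 1..2 * k}. i \<noteq> j \<longrightarrow> (\<exists>t\<in>{0..1}. u i t \<noteq> u j t))))"
proof (intro conjI impI)
  let ?A = "a 0 * exp (LBINT x=0..1. max (deriv_on {0..1} a x) 0 / a x)"
  note branch = branch_of_solutions[OF assms(2-11)]
  {
    assume "?A * (LBINT s=u0..0. f s) < 1"
    from ex_velocity_bound[OF this] obtain d where d: "0 < d" "d < 1"
      "?A * (LBINT s=u0..0. f s) \<le> 1 - sqrt (1 - d\<^sup>2)" by blast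
    have "\<exists>u. C2_solution a f u \<and> exactly_nodal_points (>) u0 u j" if "j \<in> {1..k}" for j
      using d assms(4) that
      by (intro branch[of d 0]) (auto simp: zero_ereal_def zero_less_mult_iff)
    then obtain u where u: "\<And>j. j \<in> {1..k} \<Longrightarrow> C2_solution a f (u j)"
      "\<And>j. j \<in> {1..k} \<Longrightarrow> exactly_nodal_points (>) u0 (u j) j" by metis
    have "\<not> u j constant_on {0..1}" if "j \<in> {1..k}" for j
      using exactly_nodal_points_not_constant[OF u(2)[OF that]] that by simp
    moreover have "\<exists>t\<in>{0..1}. u i t \<noteq> u j t" if "i \<in> {1..k}" "j \<in> {1..k}" "i \<noteq> j" for i j
      using exactly_nodal_points_distinct[OF u(2) u(2)] that by simp
    ultimately show "\<exists>u :: nat \<Rightarrow> real \<Rightarrow> real.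
        (\<forall>j\<in>{1..k}. C2_solution a f (u j) \<and> \<not> u j constant_on {0..1} \<and>
          exactly_nodal_points (>) u0 (u j) j) \<and>
        (\<forall>i\<in>{1..k}. \<forall>j\<in>{1..k}. i \<noteq> j \<longrightarrow> (\<exists>t\<in>{0..1}. u i t \<noteq> u j t))"
      using u by blast
  }
  {
    assume *: "interval_lebesgue_integrable lborel (ereal u0) \<infinity> f \<and>
      ?A * (LBINT s=u0..\<infinity>. f s) < 1"
    then obtain d where d: "0 < d" "d < 1" "?A * (LBINT s=u0..\<infinity>. f s) \<le> 1 - sqrt (1 - d\<^sup>2)"
      using ex_velocity_bound by blast
    \<comment> \<open>First \<open>d\<close> is fixed from the improper integral, then the start
      from \<open>d\<close>; enlarging the upper limit to infinity gives the energy bound for that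
      start.\<close>
    define c0 where "c0 = u0 + slope_of d + 1"
    have "0 \<le> slope_of d" using d by (simp add: abs_square_le_1)
    then have c0: "u0 < c0" by (simp add: c0_def)
    have "?A * (LBINT s=u0..c0. f s) \<le> ?A * (LBINT s=u0..\<infinity>. f s)"
      using * assms(3,9) c0
      by (intro mult_left_mono interval_integral_le_at_top) (auto simp: less_imp_le)
    then have energy: "?A * (LBINT s=u0..c0. f s) \<le> 1 - sqrt (1 - d\<^sup>2)" using d(3) by linarith
    have "\<exists>u. C2_solution a f u \<and> exactly_nodal_points (<) u0 u j" if "j \<in> {1..k}" for j
      using d energy c0 that
      by (intro branch[of d c0]) (auto simp: c0_def[symmetric] mult_less_0_iff)
    then obtain v where v: "\<And>j. j \<in> {1..k} \<Longrightarrow> C2_solution a f (v j)"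
      "\<And>j. j \<in> {1..k} \<Longrightarrow> exactly_nodal_points (<) u0 (v j) j" by metis
    \<comment> \<open>\<open>v\<close> is indexed by the number of nodes, and the reflection
      \<open>i \<mapsto> 2 * k + 1 - i\<close> exchanges \<open>{1..k}\<close> and
      \<open>{k + 1..2 * k}\<close>.\<close>
    define u where "u i = v (2 * k + 1 - i)" for i
    have u: "u (2 * k + 1 - l) = v l" if "l \<in> {1..k}" for l
      using that by (simp add: u_def)
    have "\<not> v j constant_on {0..1}" if "j \<in> {1..k}" for j
      using exactly_nodal_points_not_constant[OF v(2)[OF that]] that by simp
    moreover have "\<exists>t\<in>{0..1}. u i t \<noteq> u j t"
      if "i \<in> {k + 1..2 * k}" "j \<in> {k + 1..2 * k}" "i \<noteq> j" for i j
      unfolding u_def using that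
      by (intro exactly_nodal_points_distinct[OF v(2) v(2)]) auto
    ultimately show "\<exists>u :: nat \<Rightarrow> real \<Rightarrow> real.
        (\<forall>l\<in>{1..k}. C2_solution a f (u (2 * k + 1 - l)) \<and>
          \<not> u (2 * k + 1 - l) constant_on {0..1} \<and>
          exactly_nodal_points (<) u0 (u (2 * k + 1 - l)) l) \<and>
        (\<forall>i\<in>{k + 1..2 * k}. \<forall>j\<in>{k + 1..2 * k}. i \<noteq> j \<longrightarrow> (\<exists>t\<in>{0..1}. u i t \<noteq> u j t))"
      using v u by (intro exI[of _ u]) auto
  }
qed

end
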